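(* Let $d\ge2$, $p>2+\frac4d$ and $\mu>0$ be fixed. Then $$\varepsilon^{d-1}\hat{\mathcal E}_{\mathbb V^d_\varepsilon}\!\left(\frac\mu{\varepsilon^d}\right)\to-\infty\quad\text{as }\varepsilon\to0,$$ and, for every choice, for each $\varepsilon>0$ small enough, of a positive ground state $u_\varepsilon$ of $\hat E_{\mathbb V^d_\varepsilon}$ in $H^1_{\mu/\varepsilon^d}(\mathbb V^d_\varepsilon)$, $$\|\hat{\mathcal A}u_\varepsilon\|_{H^1(\mathbb R^d)}\to+\infty\quad\text{as }\varepsilon\to0 .$$
   Context: Lattice graph: for $\varepsilon>0$, $\mathbb V^d_\varepsilon=\varepsilon\mathbb Z^d$, and $x\sim y$ iff $\sum_{i=1}^d|x_i-y_i|=\varepsilon$. $\|u\|_{\ell^q(\mathbb V^d_\varepsilon)}$ is the usual $\ell^q$ norm with respect to counting measure, and $$\|\nabla^d_\varepsilon u\|^2_{\ell^2(\mathbb V^d_\varepsilon)}=\frac1{2\varepsilon}\sum_{x\in\mathbb V^d_\varepsilon}\sum_{y\sim x}|u(y)-u(x)|^2 .$$ $H^1(\mathbb V^d_\varepsilon)$ is the completion of the finitely supported real functions under the norm $(\|\nabla^d_\varepsilon u\|_{\ell^2}^2+\|u\|_{\ell^2}^2)^{1/2}$. Energy on the lattice: for $m>0$, $H^1_m(\mathbb V^d_\varepsilon)=\{u\in H^1(\mathbb V^d_\varepsilon):\|u\|^2_{\ell^2}=m\}$; $\hat E_{\mathbb V^d_\varepsilon}(u)=\frac12\|\nabla^d_\varepsilon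 u\|^2_{\ell^2}-\frac\varepsilon p\|u\|^p_{\ell^p}$; $\hat{\mathcal E}_{\mathbb V^d_\varepsilon}(m)=\inf_{H^1_m(\mathbb V^d_\varepsilon)}\hat E_{\mathbb V^d_\varepsilon}$; a ground state at mass $m$ is a $u\in H^1_m(\mathbb V^d_\varepsilon)$ attaining this infimum. Extension operator $\hat{\mathcal A}:H^1(\mathbb V^d_\varepsilon)\to H^1(\mathbb R^d)$: $\hat{\mathcal A}f$ is the continuous piecewise-affine interpolation of $f$, i.e. for every $k\in\mathbb Z^d$ and every permutation $\sigma$ of $\{1,\dots,d\}$, $\hat{\mathcal A}f$ is affine on the simplex $\{\varepsilon k+\varepsilon y:\ 1\ge y_{\sigma(1)}\ge\dots\ge y_{\sigma(d)}\ge0\}$ and coincides with $f$ at its vertices. *)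

theory Defs
  imports "HOL-Analysis.Analysis"
begin

text \<open>
  The dimension d is CARD('n).  A lattice function is given as a function on all of
  \<open>real^'n\<close>; everything below depends only on its values on the lattice, so two such
  functions represent the same lattice function iff they agree there.
\<close>

definition lattice_point :: "real \<Rightarrow> int ^ 'n::finite \<Rightarrow> real ^ 'n" where
  "lattice_point \<epsilon> k = \<epsilon> *\<^sub>R (\<chi> i. of_int (k $ i))"

definition lattice :: "real \<Rightarrow> (real ^ 'n::finite) set" where
  "lattice \<epsilon> = range (lattice_point \<epsilon>)"

definition neighbours :: "real \<Rightarrow> real ^ 'n::finite \<Rightarrow> (real ^ 'n) set" where
  "neighbours \<epsilon> x = {y \<in> lattice \<epsilon>. (\<Sum>i\<in>UNIV. \<bar>x $ i - y $ i\<bar>) = \<epsilon>}"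

definition lq_norm :: "real \<Rightarrow> real \<Rightarrow> (real ^ 'n::finite \<Rightarrow> real) \<Rightarrow> real" where
  "lq_norm \<epsilon> q u = (\<Sum>\<^sub>\<infinity>x\<in>lattice \<epsilon>. \<bar>u x\<bar> powr q) powr (1 / q)"

definition grad_norm_sq :: "real \<Rightarrow> (real ^ 'n::finite \<Rightarrow> real) \<Rightarrow> real" where
  "grad_norm_sq \<epsilon> u =
     1 / (2 * \<epsilon>) * (\<Sum>\<^sub>\<infinity>x\<in>lattice \<epsilon>. \<Sum>y\<in>neighbours \<epsilon> x. \<bar>u y - u x\<bar>\<^sup>2)"

definition lattice_H1_norm :: "real \<Rightarrow> (real ^ 'n::finite \<Rightarrow> real) \<Rightarrow> real" where
  "lattice_H1_norm \<epsilon> u = sqrt (grad_norm_sq \<epsilon> u + (lq_norm \<epsilon> 2 u)\<^sup>2)"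

text \<open>
  An infinite sum of a non-summable family is 0 by convention, so finiteness of the norm
  has to be stated separately.
\<close>

definition finite_lattice_H1_norm :: "real \<Rightarrow> (real ^ 'n::finite \<Rightarrow> real) \<Rightarrow> bool" where
  "finite_lattice_H1_norm \<epsilon> u \<longleftrightarrow>
     (\<lambda>x. \<bar>u x\<bar> powr 2) summable_on lattice \<epsilon> \<and>
     (\<lambda>x. \<Sum>y\<in>neighbours \<epsilon> x. \<bar>u y - u x\<bar>\<^sup>2) summable_on lattice \<epsilon>"

definition finitely_supported :: "real \<Rightarrow> (real ^ 'n::finite \<Rightarrow> real) \<Rightarrow> bool" where
  "finitely_supported \<epsilon> u \<longleftrightarrow> finite {x \<in> lattice \<epsilon>. u x \<noteq> 0}"

text \<open>
  The completion of the finitely supported functions, realised as their closure in the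
  (complete) space of all lattice functions with finite norm.
\<close>

definition lattice_H1 :: "real \<Rightarrow> (real ^ 'n::finite \<Rightarrow> real) set" where
  "lattice_H1 \<epsilon> = {u. \<exists>\<phi>. (\<forall>n::nat. finitely_supported \<epsilon> (\<phi> n) \<and>
                              finite_lattice_H1_norm \<epsilon> (\<lambda>x. u x - \<phi> n x)) \<and>
                        (\<lambda>n. lattice_H1_norm \<epsilon> (\<lambda>x. u x - \<phi> n x)) \<longlonglongrightarrow> 0}"

definition lattice_H1_mass :: "real \<Rightarrow> real \<Rightarrow> (real ^ 'n::finite \<Rightarrow> real) set" where
  "lattice_H1_mass \<epsilon> m = {u \<in> lattice_H1 \<epsilon>. (lq_norm \<epsilon> 2 u)\<^sup>2 = m}"

definition lattice_energy :: "real \<Rightarrow> real \<Rightarrow> (real ^ 'n::finite \<Rightarrow> real) \<Rightarrow> real" where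
  "lattice_energy \<epsilon> p u = 1 / 2 * grad_norm_sq \<epsilon> u - \<epsilon> / p * lq_norm \<epsilon> p u powr p"

text \<open>The infimum is taken in the extended reals, so that no boundedness is presupposed.\<close>

definition lattice_energy_level :: "'n::finite itself \<Rightarrow> real \<Rightarrow> real \<Rightarrow> real \<Rightarrow> ereal" where
  "lattice_energy_level (_ :: 'n itself) \<epsilon> p m =
     (INF u \<in> (lattice_H1_mass \<epsilon> m :: (real ^ 'n \<Rightarrow> real) set). ereal (lattice_energy \<epsilon> p u))"

definition ground_state :: "real \<Rightarrow> real \<Rightarrow> real \<Rightarrow> (real ^ 'n::finite \<Rightarrow> real) \<Rightarrow> bool" where
  "ground_state \<epsilon> p m u \<longleftrightarrow>
     u \<in> lattice_H1_mass \<epsilon> m \<and>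
     ereal (lattice_energy \<epsilon> p u) = lattice_energy_level TYPE('n) \<epsilon> p m"

definition positive_on_lattice :: "real \<Rightarrow> (real ^ 'n::finite \<Rightarrow> real) \<Rightarrow> bool" where
  "positive_on_lattice \<epsilon> u \<longleftrightarrow> (\<forall>x\<in>lattice \<epsilon>. u x > 0)"


text \<open>
  Permutations of the coordinates are encoded as bijections \<open>\<sigma>\<close> from {1..d} onto the
  index type.  The vertices of the simplex belonging to k and \<open>\<sigma>\<close> are the d + 1 points
  where the first r coordinates of y, in the order given by \<open>\<sigma>\<close>, are 1 and the others 0.
\<close>

definition coord_order :: "(nat \<Rightarrow> 'n::finite) \<Rightarrow> bool" where
  "coord_order \<sigma> \<longleftrightarrow> bij_betw \<sigma> {1..CARD('n)} UNIV"

definition cell_simplex ::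
  "real \<Rightarrow> int ^ 'n::finite \<Rightarrow> (nat \<Rightarrow> 'n) \<Rightarrow> (real ^ 'n) set" where
  "cell_simplex \<epsilon> k \<sigma> =
     {lattice_point \<epsilon> k + \<epsilon> *\<^sub>R y | y.
        (\<forall>j\<in>{1..CARD('n)}. 0 \<le> y $ \<sigma> j \<and> y $ \<sigma> j \<le> 1) \<and>
        (\<forall>i\<in>{1..CARD('n)}. \<forall>j\<in>{1..CARD('n)}. i \<le> j \<longrightarrow> y $ \<sigma> j \<le> y $ \<sigma> i)}"

definition simplex_vertex ::
  "real \<Rightarrow> int ^ 'n::finite \<Rightarrow> (nat \<Rightarrow> 'n) \<Rightarrow> nat \<Rightarrow> real ^ 'n" where
  "simplex_vertex \<epsilon> k \<sigma> r = lattice_point \<epsilon> k + \<epsilon> *\<^sub>R (\<Sum>j\<in>{1..r}. axis (\<sigma> j) 1)"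

definition affine_interpolation ::
  "real \<Rightarrow> (real ^ 'n::finite \<Rightarrow> real) \<Rightarrow> (real ^ 'n \<Rightarrow> real) \<Rightarrow> bool" where
  "affine_interpolation \<epsilon> f w \<longleftrightarrow>
     continuous_on UNIV w \<and>
     (\<forall>k \<sigma>. coord_order \<sigma> \<longrightarrow>
        (\<exists>a b. \<forall>x\<in>cell_simplex \<epsilon> k \<sigma>. w x = a \<bullet> x + b) \<and>
        (\<forall>r\<le>CARD('n). w (simplex_vertex \<epsilon> k \<sigma> r) = f (simplex_vertex \<epsilon> k \<sigma> r)))"

definition extension_op ::
  "real \<Rightarrow> (real ^ 'n::finite \<Rightarrow> real) \<Rightarrow> (real ^ 'n \<Rightarrow> real)" where
  "extension_op \<epsilon> f = (THE w. affine_interpolation \<epsilon> f w)"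


definition partial_deriv :: "'n::finite \<Rightarrow> (real ^ 'n \<Rightarrow> real) \<Rightarrow> (real ^ 'n \<Rightarrow> real)" where
  "partial_deriv i f = (\<lambda>x. frechet_derivative f (at x) (axis i 1))"

primrec C_k :: "nat \<Rightarrow> (real ^ 'n::finite \<Rightarrow> real) \<Rightarrow> bool" where
  "C_k 0 f \<longleftrightarrow> continuous_on UNIV f"
| "C_k (Suc k) f \<longleftrightarrow> (\<forall>x. f differentiable at x) \<and> (\<forall>i. C_k k (partial_deriv i f))"

definition test_function :: "(real ^ 'n::finite \<Rightarrow> real) \<Rightarrow> bool" where
  "test_function \<phi> \<longleftrightarrow> (\<forall>k. C_k k \<phi>) \<and> compact (closure {x. \<phi> x \<noteq> 0})"

definition square_integrable :: "(real ^ 'n::finite \<Rightarrow> real) \<Rightarrow> bool" where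
  "square_integrable w \<longleftrightarrow> w \<in> borel_measurable lborel \<and> integrable lborel (\<lambda>x. (w x)\<^sup>2)"

text \<open>\<open>g\<close> is a weak i-th partial derivative of \<open>w\<close> lying in \<open>L\<^sup>2\<close>.\<close>

definition is_weak_partial ::
  "'n::finite \<Rightarrow> (real ^ 'n \<Rightarrow> real) \<Rightarrow> (real ^ 'n \<Rightarrow> real) \<Rightarrow> bool" where
  "is_weak_partial i w g \<longleftrightarrow>
     square_integrable g \<and>
     (\<forall>\<phi>. test_function \<phi> \<longrightarrow>
        (\<integral>x. w x * partial_deriv i \<phi> x \<partial>lborel) = - (\<integral>x. g x * \<phi> x \<partial>lborel))"

text \<open>
  For \<open>w\<close> in \<open>H\<^sup>1\<close> the weak derivative exists and is unique up to null sets, so the norm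
  below does not depend on the choice; outside \<open>H\<^sup>1\<close> its value is meaningless.
\<close>

definition weak_partial :: "'n::finite \<Rightarrow> (real ^ 'n \<Rightarrow> real) \<Rightarrow> (real ^ 'n \<Rightarrow> real)" where
  "weak_partial i w = (SOME g. is_weak_partial i w g)"

definition H1_norm :: "(real ^ 'n::finite \<Rightarrow> real) \<Rightarrow> real" where
  "H1_norm w = sqrt ((\<Sum>i\<in>UNIV. \<integral>x. (weak_partial i w x)\<^sup>2 \<partial>lborel) + (\<integral>x. (w x)\<^sup>2 \<partial>lborel))"

end

theory Submission
  imports Defs "HOL-Real_Asymp.Real_Asymp"
begin

text \<open>
  A multiple of the delta function at the origin with the prescribed mass has scaled energy
  \<open>O(\<epsilon>\<^sup>-\<^sup>2) - c \<epsilon> powr (- d (p - 2) / 2)\<close>, which tends to \<open>-\<infinity>\<close> because \<open>d (p - 2) / 2 > 2\<close>.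

  Comparing with this function, a ground state has an \<open>\<ell>\<^sup>p\<close> norm so large that at some
  lattice point x its value is at least a constant times \<open>\<epsilon> powr (- d / 2)\<close>.  Testing a weak
  derivative of the interpolation w against a bump function supported in a tube of
  length 1 and width \<open>\<epsilon>\<close> starting at x then gives
  \<open>c w(x) \<epsilon> powr ((d - 1) / 2) \<le> \<parallel>w\<parallel>\<^sup>2 + \<parallel>g\<parallel>\<^sup>2 + 2\<close>, so that the squared norm is at least
  of order \<open>\<epsilon> powr (- 1 / 2)\<close>.

  Since the norm is defined through a chosen weak derivative, a weak derivative of w has to be exhibited.  The
  interpolation is \<open>w(x) = \<integral>\<^sub>0\<^sup>1 u(\<epsilon> \<lfloor>x / \<epsilon> + t\<rfloor>) dt\<close>, with t added to every coordinate, from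
  which continuity, Lipschitz bounds and square integrability are read off; it is
  differentiable off the boundaries of the simplices, which are null sets by convexity.
\<close>

subsection \<open>A smooth bump function\<close>

text \<open>A height of order \<epsilon>^(-d/2) on a single cell contributes only O(1) to the
  squared L2 norm, so the mass alone does not detect the blow-up. For d at least 2 the H1 norm does
  not control point values, and for d at least 3 the exponent p may lie above the Sobolev exponent,
  so neither the height nor the lp norm bounds the H1 norm by an embedding. The height itself comes
  from the elementary inequality sum |u|^p <= (sup |u|)^(p-2) * sum |u|^2, valid for every p > 2.
  The passage to H1 exploits the mesh: since u is positive, the interpolation keeps at least half of
  a nodal value on a whole cube of side \<epsilon>/4. Along a tube of unit length through that cube,
  w either persists, which costs mass, or decreases, which costs gradient. The cube contributes w(x)
  * \<epsilon>^d / \<epsilon> up to constants; the tube has volume \<epsilon>^(d-1), so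
  Cauchy-Schwarz bounds the cost by \<epsilon>^((d-1)/2) times the norms of w and g. With w(x) of
  order \<epsilon>^(-d/2) the quotient still diverges.\<close>

text \<open>This family is closed under differentiation, so its members are smooth.\<close>

definition flat :: "real poly \<Rightarrow> real \<Rightarrow> real" where
  "flat P t = (if t > 0 then poly P (1 / t) * exp (- (1 / t)) else 0)"

lemma poly_times_exp_tendsto_0:
  "((\<lambda>s. poly P s * exp (- s)) \<longlongrightarrow> 0) (at_top :: real filter)"
proof -
  have "((\<lambda>s. \<Sum>i\<le>degree P. coeff P i * (s ^ i / exp s)) \<longlongrightarrow> (\<Sum>i\<le>degree P. coeff P i * 0)) at_top"
    by (intro tendsto_sum tendsto_mult tendsto_const tendsto_power_div_exp_0)
  then show ?thesis
    by (simp add: poly_altdef sum_distrib_right exp_minus divide_inverse mult.assoc)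
qed

text \<open>With s = 1/t one has d/dt = - s^2 d/ds, and applied to P(s) exp(-s) this gives s^2 (P -
  P')(s) exp(-s); the factor \<open>[:0, 0, 1:]\<close> is s^2. At the origin the exponential beats
  every power of 1/t.\<close>

lemma DERIV_flat:
  "(flat P has_real_derivative flat ([:0, 0, 1:] * (P - pderiv P)) t) (at t)"
proof -
  consider "t > 0" | "t < 0" | "t = 0" by linarith
  then show ?thesis
  proof cases
    case 1
    have "((\<lambda>s. poly P (1 / s) * exp (- (1 / s))) has_real_derivative
        flat ([:0, 0, 1:] * (P - pderiv P)) t) (at t)"
      using 1 by (auto intro!: derivative_eq_intros poly_DERIV[THEN DERIV_chain2]
          simp: flat_def field_simps power2_eq_square)
    moreover have "\<forall>\<^sub>F s in nhds t. poly P (1 / s) * exp (- (1 / s)) = flat P s"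
      using eventually_nhds_in_open[of "{0<..}" t] 1
      by (auto simp: flat_def elim: eventually_mono)
    ultimately show ?thesis
      by (subst DERIV_cong_ev[OF refl _ refl, symmetric])
  next
    case 2
    have "((\<lambda>s. 0) has_real_derivative flat ([:0, 0, 1:] * (P - pderiv P)) t) (at t)"
      using 2 by (auto simp: flat_def)
    moreover have "\<forall>\<^sub>F s in nhds t. 0 = flat P s"
      using eventually_nhds_in_open[of "{..<0}" t] 2
      by (auto simp: flat_def elim: eventually_mono)
    ultimately show ?thesis
      by (subst DERIV_cong_ev[OF refl _ refl, symmetric])
  next
    case 3
    \<comment> \<open>The right difference quotient at 0 is s P(s) exp(-s) with s = 1/h, again a
      polynomial times the exponential.\<close>
    have "((\<lambda>h. poly ([:0, 1:] * P) (inverse h) * exp (- inverse h)) \<longlongrightarrow> 0) (at_right (0 :: real))"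
      using filterlim_compose[OF poly_times_exp_tendsto_0 filterlim_inverse_at_top_right] .
    then have "((\<lambda>h. flat P h / h) \<longlongrightarrow> 0) (at_right 0)"
      by (rule Lim_transform_eventually)
        (auto simp: flat_def eventually_at_filter field_simps)
    moreover have "((\<lambda>h. flat P h / h) \<longlongrightarrow> 0) (at_left 0)"
      by (rule Lim_transform_eventually[OF tendsto_const])
        (auto simp: flat_def eventually_at_filter)
    ultimately have "((\<lambda>h. flat P h / h) \<longlongrightarrow> 0) (at 0)"
      by (rule filterlim_split_at[rotated])
    then show ?thesis
      using 3 by (auto simp: DERIV_def flat_def)
  qed
qed

section \<open>Closure properties of the classes \<open>C_k\<close>\<close>

lemma has_derivative_imp_partial_deriv:
  fixes f :: "real ^ 'n::finite \<Rightarrow> real"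
  assumes "\<And>x. (f has_derivative f' x) (at x)"
  shows "f differentiable (at x)" "partial_deriv i f = (\<lambda>x. f' x (axis i 1))"
  using assms frechet_derivative_at[OF assms]
  by (auto simp: differentiable_def partial_deriv_def fun_eq_iff)

lemma C_k_imp_differentiable:
  "C_k (Suc k) f \<Longrightarrow> (f has_derivative frechet_derivative f (at x)) (at x)"
  using frechet_derivative_works by auto

text \<open>\<open>C_k\<close> recurses on derivatives only, so the lower orders have to be
  recovered; the Leibniz rule uses this for the factor that is not differentiated.\<close>

lemma C_k_lower: "C_k (Suc k) f \<Longrightarrow> C_k k f"
proof (induction k arbitrary: f)
  case 0
  then show ?case
    by (auto intro!: differentiable_imp_continuous_on simp: differentiable_on_def
        intro: differentiable_at_withinI)
next
  case (Suc k)
  then show ?case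
    by (metis C_k.simps(2))
qed

lemma C_k_add:
  fixes f g :: "real ^ 'n::finite \<Rightarrow> real"
  shows "C_k k f \<Longrightarrow> C_k k g \<Longrightarrow> C_k k (\<lambda>x. f x + g x)"
proof (induction k arbitrary: f g)
  case 0
  then show ?case by (auto intro: continuous_intros)
next
  case (Suc k)
  note d = has_derivative_add[OF C_k_imp_differentiable[OF Suc.prems(1)] C_k_imp_differentiable[OF Suc.prems(2)]]
  have "C_k k (\<lambda>x. partial_deriv i f x + partial_deriv i g x)" for i
    using Suc by auto
  then show ?case
    using has_derivative_imp_partial_deriv[OF d] by (auto simp: partial_deriv_def)
qed

lemma C_k_mult:
  fixes f g :: "real ^ 'n::finite \<Rightarrow> real"
  shows "C_k k f \<Longrightarrow> C_k k g \<Longrightarrow> C_k k (\<lambda>x. f x * g x)"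
proof (induction k arbitrary: f g)
  case 0
  then show ?case by (auto intro: continuous_intros)
next
  case (Suc k)
  note d = has_derivative_mult[OF C_k_imp_differentiable[OF Suc.prems(1)] C_k_imp_differentiable[OF Suc.prems(2)]]
  have "C_k k (\<lambda>x. f x * partial_deriv i g x + partial_deriv i f x * g x)" for i
    using Suc C_k_lower[of k f] C_k_lower[of k g] by (intro C_k_add Suc.IH) auto
  then show ?case
    using has_derivative_imp_partial_deriv[OF d] by (auto simp: partial_deriv_def)
qed

lemma has_derivative_flat_coord:
  fixes a b :: real
  shows "((\<lambda>x :: real ^ 'n::finite. flat P (a + b * x $ i)) has_derivative
      (\<lambda>h. flat ([:0, 0, 1:] * (P - pderiv P)) (a + b * x $ i) * (b * h $ i))) (at x)"
proof -
  have 1: "((\<lambda>x :: real ^ 'n. a + b * x $ i) has_derivative (\<lambda>h. b * h $ i)) (at x)"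
    by (auto intro!: derivative_eq_intros bounded_linear.has_derivative[OF bounded_linear_vec_nth])
  show ?thesis
    using has_derivative_compose[OF 1 DERIV_flat[unfolded has_field_derivative_def]] .
qed

lemma C_k_flat_coord:
  fixes a b :: real
  shows "C_k k (\<lambda>x :: real ^ 'n::finite. flat P (a + b * x $ i))"
proof (induction k arbitrary: P)
  case 0
  then show ?case
    using has_derivative_continuous[OF has_derivative_flat_coord[of P a b i]]
    by (auto intro!: continuous_at_imp_continuous_on)
next
  case (Suc k)
  \<comment> \<open>The constant b, or 0 in the other directions, is absorbed into the polynomial,
    so that the derivative has the form required by the induction hypothesis for another P.\<close>
  have "partial_deriv j (\<lambda>x :: real ^ 'n. flat P (a + b * x $ i)) =
      (\<lambda>x. flat (smult (b * axis j 1 $ i) ([:0, 0, 1:] * (P - pderiv P))) (a + b * x $ i))" for j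
    by (subst has_derivative_imp_partial_deriv(2)[OF has_derivative_flat_coord]) (simp add: flat_def fun_eq_iff)
  then show ?case
    using Suc has_derivative_imp_partial_deriv(1)[OF has_derivative_flat_coord[where ?'n = 'n, of P a b i]] by simp
qed

lemma C_k_const: "C_k k (\<lambda>x :: real ^ 'n::finite. c :: real)"
proof (induction k arbitrary: c)
  case (Suc k)
  then show ?case
    using has_derivative_imp_partial_deriv(2)[OF has_derivative_const[where ?'a = "real ^ 'n", of c]] by simp
qed auto

lemma C_k_prod:
  fixes f :: "'i \<Rightarrow> real ^ 'n::finite \<Rightarrow> real"
  assumes "\<And>i. i \<in> I \<Longrightarrow> C_k k (f i)"
  shows "C_k k (\<lambda>x. \<Prod>i\<in>I. f i x)"
  using assms by (induction I rule: infinite_finite_induct) (auto intro: C_k_const C_k_mult)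

subsection \<open>Weak derivatives from difference quotients\<close>

lemma DERIV_partial_deriv:
  fixes f :: "real ^ 'n::finite \<Rightarrow> real"
  assumes "f differentiable (at (x + t *\<^sub>R axis i 1))"
  shows "((\<lambda>t. f (x + t *\<^sub>R axis i 1)) has_real_derivative
    partial_deriv i f (x + t *\<^sub>R axis i 1)) (at t)"
proof -
  let ?f' = "frechet_derivative f (at (x + t *\<^sub>R axis i 1))"
  have 1: "((\<lambda>t. x + t *\<^sub>R axis i 1) has_derivative (\<lambda>t. t *\<^sub>R axis i 1)) (at t)"
    by (auto intro!: derivative_eq_intros)
  have "(f has_derivative ?f') (at (x + t *\<^sub>R axis i 1))"
    using assms(1) by (simp add: frechet_derivative_works)
  from has_derivative_compose[OF 1 this]
  have "((\<lambda>t. f (x + t *\<^sub>R axis i 1)) has_derivative (\<lambda>s. ?f' (s *\<^sub>R axis i 1))) (at t)" .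
  moreover have "linear ?f'"
    using assms(1) by (rule linear_frechet_derivative)
  ultimately have "((\<lambda>t. f (x + t *\<^sub>R axis i 1)) has_derivative (\<lambda>s. ?f' (axis i 1) * s)) (at t)"
    by (simp add: linear_cmul mult.commute)
  then show ?thesis
    unfolding has_field_derivative_def partial_deriv_def .
qed

text \<open>Once differentiability is known, a partial derivative can be computed along a single
  line, without writing down the full derivative.\<close>

lemma partial_deriv_eq_DERIV:
  fixes f :: "real ^ 'n::finite \<Rightarrow> real"
  assumes "f differentiable (at x)"
    and "((\<lambda>t. f (x + t *\<^sub>R axis i 1)) has_real_derivative D) (at 0)"
  shows "partial_deriv i f x = D"
  using DERIV_partial_deriv[of f x 0 i] assms DERIV_unique by fastforce

lemma test_function_bounded_support:
  assumes "test_function \<phi>"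
  obtains R where "\<And>x. norm x > R \<Longrightarrow> \<phi> x = 0"
proof -
  have "bounded (closure {x. \<phi> x \<noteq> 0})"
    using assms compact_imp_bounded unfolding test_function_def by blast
  then obtain R where "\<forall>x \<in> closure {x. \<phi> x \<noteq> 0}. norm x \<le> R"
    unfolding bounded_iff by blast
  then have "\<phi> x = 0" if "norm x > R" for x
    using closure_subset[of "{x. \<phi> x \<noteq> 0}"] that by force
  then show ?thesis by (rule that)
qed

lemma test_function_differentiable: "test_function \<phi> \<Longrightarrow> \<phi> differentiable (at x)"
  using C_k.simps(2)[of 0 \<phi>] unfolding test_function_def by blast

lemma test_function_continuous: "test_function \<phi> \<Longrightarrow> continuous_on UNIV \<phi>"
  using C_k.simps(1)[of \<phi>] unfolding test_function_def by blast

lemma test_function_continuous_partial: "test_function \<phi> \<Longrightarrow> continuous_on UNIV (partial_deriv i \<phi>)"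
  using C_k.simps(2)[of 0 \<phi>] unfolding test_function_def by auto

lemma partial_deriv_eq_0_outside_closed:
  fixes \<phi> :: "real ^ 'n::finite \<Rightarrow> real"
  assumes \<phi>: "test_function \<phi>" and T: "closed T" "\<And>y. y \<notin> T \<Longrightarrow> \<phi> y = 0" and x: "x \<notin> T"
  shows "partial_deriv i \<phi> x = 0"
proof (rule partial_deriv_eq_DERIV[OF test_function_differentiable[OF \<phi>]])
  have "\<forall>\<^sub>F t in nhds 0. (x + t *\<^sub>R axis i 1) \<in> - T"
  proof (rule topological_tendstoD)
    show "((\<lambda>t. x + t *\<^sub>R axis i 1) \<longlongrightarrow> x) (nhds 0)"
      by (auto intro!: tendsto_eq_intros filterlim_ident)
  qed (use T x in auto)
  then have "\<forall>\<^sub>F t in nhds 0. \<phi> (x + t *\<^sub>R axis i 1) = 0"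
    by (rule eventually_mono) (use T in auto)
  then show "((\<lambda>t. \<phi> (x + t *\<^sub>R axis i 1)) has_real_derivative 0) (at 0)"
    by (subst DERIV_cong_ev[OF refl _ refl, where g = "\<lambda>_. 0"]) auto
qed

lemma test_function_Lipschitz:
  fixes \<phi> :: "real ^ 'n::finite \<Rightarrow> real"
  assumes \<phi>: "test_function \<phi>"
  obtains K where "K \<ge> 0" "\<And>x h. h \<ge> 0 \<Longrightarrow> \<bar>\<phi> (x - h *\<^sub>R axis i 1) - \<phi> x\<bar> \<le> K * h"
proof -
  obtain R where R: "\<And>x. norm x > R \<Longrightarrow> \<phi> x = 0"
    using test_function_bounded_support[OF \<phi>] by blast
  have zero: "partial_deriv i \<phi> x = 0" if "norm x > R" for x
    using that R by (intro partial_deriv_eq_0_outside_closed[OF \<phi>, of "cball 0 R"]) auto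
  have "compact (partial_deriv i \<phi> ` cball 0 R)"
    by (intro compact_continuous_image continuous_on_subset[OF test_function_continuous_partial[OF \<phi>]]) auto
  then have "bounded (partial_deriv i \<phi> ` cball 0 R)"
    by (rule compact_imp_bounded)
  then obtain K0 where K0: "\<And>y. y \<in> partial_deriv i \<phi> ` cball 0 R \<Longrightarrow> \<bar>y\<bar> \<le> K0"
    unfolding bounded_iff real_norm_def by blast
  \<comment> \<open>For negative R the ball is empty and \<open>K0\<close> could be negative, hence
    the maximum with 0.\<close>
  have K: "\<bar>partial_deriv i \<phi> x\<bar> \<le> max K0 0" for x
  proof (cases "norm x > R")
    case True
    then show ?thesis by (simp add: zero)
  next
    case False
    then have "x \<in> cball 0 R" by simp
    from K0[OF imageI[OF this]] show ?thesis by (rule max.coboundedI1)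
  qed
  have "\<bar>\<phi> (x - h *\<^sub>R axis i 1) - \<phi> x\<bar> \<le> max K0 0 * h" if "h \<ge> 0" for x h
  proof (cases "h = 0")
    case False
    define y where "y = x - h *\<^sub>R axis i 1"
    have "0 < h" using False that by simp
    from MVT2[OF this, of "\<lambda>t. \<phi> (y + t *\<^sub>R axis i 1)",
        OF DERIV_partial_deriv[OF test_function_differentiable[OF \<phi>]]]
    obtain t where "\<phi> (y + h *\<^sub>R axis i 1) - \<phi> (y + 0 *\<^sub>R axis i 1) =
        (h - 0) * partial_deriv i \<phi> (y + t *\<^sub>R axis i 1)"
      by blast
    then have "\<bar>\<phi> x - \<phi> y\<bar> = h * \<bar>partial_deriv i \<phi> (y + t *\<^sub>R axis i 1)\<bar>"
      using that by (simp add: y_def abs_mult)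
    also have "\<dots> \<le> h * max K0 0"
      by (intro mult_left_mono K that)
    finally show ?thesis
      by (simp add: y_def mult.commute abs_minus_commute)
  qed simp
  then show ?thesis
    using that[of "max K0 0"] by simp
qed

lemma integrable_continuous_bounded_support:
  fixes f :: "real ^ 'n::finite \<Rightarrow> real"
  assumes "continuous_on UNIV f" "\<And>x. norm x > R \<Longrightarrow> f x = 0"
  shows "integrable lborel f"
proof -
  have "integrable lborel (\<lambda>x. indicator (cball 0 R) x *\<^sub>R f x)"
    by (intro borel_integrable_compact continuous_on_subset[OF assms(1)]) auto
  also have "(\<lambda>x. indicator (cball 0 R) x *\<^sub>R f x) = f"
    using assms(2) by (auto simp: fun_eq_iff indicator_def not_le)
  finally show ?thesis .
qed

lemma integral_lborel_translate:
  fixes f :: "'a::euclidean_space \<Rightarrow> real"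
  assumes "f \<in> borel_measurable borel"
  shows "(\<integral>x. f (x + c) \<partial>lborel) = (\<integral>x. f x \<partial>lborel)"
proof -
  have "(\<integral>x. f x \<partial>lborel) = (\<integral>x. f x \<partial>distr lborel borel ((+) c))"
    by (simp add: lborel_distr_plus)
  also have "\<dots> = (\<integral>x. f (c + x) \<partial>lborel)"
    by (intro integral_distr) (use assms in auto)
  finally show ?thesis by (simp add: add.commute)
qed

text \<open>Summation by parts for difference quotients: translation invariance of Lebesgue measure
  moves the quotient from w to the test function, and dominated convergence passes to the limit on
  both sides. The Lipschitz bound dominates the quotients of w, and the compact support of the test
  function makes everything integrable. The pointwise limit is required only almost everywhere,
  which suits a piecewise-affine w.\<close>

lemma is_weak_partial_of_difference_quotient:
  fixes w g :: "real ^ 'n::finite \<Rightarrow> real"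
  assumes w: "continuous_on UNIV w"
    and g: "square_integrable g"
    and L: "\<And>x h. 0 \<le> h \<Longrightarrow> h \<le> 1 \<Longrightarrow> \<bar>w (x + h *\<^sub>R axis i 1) - w x\<bar> \<le> L * h"
    and lim: "AE x in lborel. (\<lambda>n. (w (x + (1 / real (Suc n)) *\<^sub>R axis i 1) - w x) * real (Suc n)) \<longlonglongrightarrow> g x"
  shows "is_weak_partial i w g"
  unfolding is_weak_partial_def
proof (intro conjI allI impI g)
  fix \<phi> :: "real ^ 'n \<Rightarrow> real"
  assume \<phi>: "test_function \<phi>"
  let ?e = "axis i 1 :: real ^ 'n"
  let ?h = "\<lambda>n. 1 / real (Suc n)"
  have h: "0 \<le> ?h n" "?h n \<le> 1" for n by auto
  have gm [measurable]: "g \<in> borel_measurable borel"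
    using g by (simp add: square_integrable_def)
  have wm [measurable]: "w \<in> borel_measurable borel"
    using w by (rule borel_measurable_continuous_onI)
  have \<phi>c: "continuous_on UNIV \<phi>" using test_function_continuous[OF \<phi>] .
  have \<phi>m [measurable]: "\<phi> \<in> borel_measurable borel"
    using \<phi>c by (rule borel_measurable_continuous_onI)
  have [measurable]: "partial_deriv i \<phi> \<in> borel_measurable borel"
    using test_function_continuous_partial[OF \<phi>] by (rule borel_measurable_continuous_onI)
  obtain R where R: "\<And>x. norm x > R \<Longrightarrow> \<phi> x = 0"
    using test_function_bounded_support[OF \<phi>] by blast
  obtain K where K: "K \<ge> 0" "\<And>x h. h \<ge> 0 \<Longrightarrow> \<bar>\<phi> (x - h *\<^sub>R ?e) - \<phi> x\<bar> \<le> K * h"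
    using test_function_Lipschitz[OF \<phi>] by blast
  have R': "\<phi> (x - ?h n *\<^sub>R ?e) = 0" if "norm x > R + 1" for x n
  proof (rule R)
    have "norm x \<le> norm (x - ?h n *\<^sub>R ?e) + norm (?h n *\<^sub>R ?e)"
      by (metis diff_add_cancel norm_triangle_ineq)
    also have "norm (?h n *\<^sub>R ?e) \<le> 1" using h[of n] by simp
    finally show "R < norm (x - ?h n *\<^sub>R ?e)" using that by simp
  qed
  have shift: "continuous_on UNIV (\<lambda>x. f (x + c))" if "continuous_on UNIV f" for f :: "real ^ 'n \<Rightarrow> real" and c
    by (rule continuous_on_compose2[OF that]) (auto intro: continuous_intros)
  have int1: "integrable lborel (\<lambda>x. w (x + ?h n *\<^sub>R ?e) * \<phi> x)" for n
    by (rule integrable_continuous_bounded_support[where R = R])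
      (auto intro!: continuous_on_mult shift w \<phi>c simp: R)
  have int2: "integrable lborel (\<lambda>x. w x * \<phi> x)"
    by (rule integrable_continuous_bounded_support[where R = R])
      (auto intro!: continuous_on_mult shift w \<phi>c simp: R)
  have int3: "integrable lborel (\<lambda>x. w x * \<phi> (x - ?h n *\<^sub>R ?e))" for n
    using shift[OF \<phi>c, of "- (?h n *\<^sub>R ?e)"]
    by (intro integrable_continuous_bounded_support[where R = "R + 1"])
      (auto intro!: continuous_on_mult w simp: R' simp del: of_nat_Suc)
  \<comment> \<open>The discrete integration by parts; the backward step on the test function
    produces the minus sign in the limit.\<close>
  have "(\<integral>x. (w (x + ?h n *\<^sub>R ?e) - w x) * real (Suc n) * \<phi> x \<partial>lborel) =
      (\<integral>x. w x * ((\<phi> (x - ?h n *\<^sub>R ?e) - \<phi> x) * real (Suc n)) \<partial>lborel)" for n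
  proof -
    have "(\<integral>x. w (x + ?h n *\<^sub>R ?e) * \<phi> x \<partial>lborel) =
        (\<integral>x. w x * \<phi> (x - ?h n *\<^sub>R ?e) \<partial>lborel)"
      using integral_lborel_translate[of "\<lambda>x. w x * \<phi> (x - ?h n *\<^sub>R ?e)" "?h n *\<^sub>R ?e"] by simp
    moreover have "(\<lambda>x. (w (x + ?h n *\<^sub>R ?e) - w x) * real (Suc n) * \<phi> x) =
        (\<lambda>x. real (Suc n) * (w (x + ?h n *\<^sub>R ?e) * \<phi> x - w x * \<phi> x))"
      by (auto simp: algebra_simps simp del: of_nat_Suc)
    moreover have "(\<lambda>x. w x * ((\<phi> (x - ?h n *\<^sub>R ?e) - \<phi> x) * real (Suc n))) =
        (\<lambda>x. real (Suc n) * (w x * \<phi> (x - ?h n *\<^sub>R ?e) - w x * \<phi> x))"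
      by (auto simp: algebra_simps simp del: of_nat_Suc)
    ultimately show ?thesis
      by (simp only: integral_mult_right_zero Bochner_Integration.integral_diff[OF int1 int2]
          Bochner_Integration.integral_diff[OF int3 int2])
  qed
  moreover have "(\<lambda>n. \<integral>x. (w (x + ?h n *\<^sub>R ?e) - w x) * real (Suc n) * \<phi> x \<partial>lborel)
      \<longlonglongrightarrow> (\<integral>x. g x * \<phi> x \<partial>lborel)"
  proof (rule integral_dominated_convergence[where w = "\<lambda>x. L * \<bar>\<phi> x\<bar>"])
    show "integrable lborel (\<lambda>x. L * \<bar>\<phi> x\<bar>)"
      using integrable_continuous_bounded_support[OF \<phi>c R] by auto
    show "AE x in lborel. (\<lambda>n. (w (x + ?h n *\<^sub>R ?e) - w x) * real (Suc n) * \<phi> x) \<longlonglongrightarrow> g x * \<phi> x"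
      using lim by eventually_elim (intro tendsto_mult tendsto_const)
    have "\<bar>(w (x + ?h n *\<^sub>R ?e) - w x) * real (Suc n)\<bar> \<le> L" for n x
      using mult_right_mono[OF L[OF h(1) h(2), of x n], of "real (Suc n)"]
      by (simp add: abs_mult del: of_nat_Suc)
    then show "AE x in lborel. norm ((w (x + ?h n *\<^sub>R ?e) - w x) * real (Suc n) * \<phi> x) \<le> L * \<bar>\<phi> x\<bar>" for n
      by (intro AE_I2) (auto simp: abs_mult intro!: mult_right_mono)
  qed measurable
  moreover have "(\<lambda>n. \<integral>x. w x * ((\<phi> (x - ?h n *\<^sub>R ?e) - \<phi> x) * real (Suc n)) \<partial>lborel)
      \<longlonglongrightarrow> (\<integral>x. w x * (- partial_deriv i \<phi> x) \<partial>lborel)"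
  \<comment> \<open>Shifts by at most 1 keep the supports inside the ball of radius R + 1.\<close>
  proof (rule integral_dominated_convergence[where w = "\<lambda>x. indicator (cball 0 (R + 1)) x *\<^sub>R (\<bar>w x\<bar> * K)"])
    show "integrable lborel (\<lambda>x. indicator (cball 0 (R + 1)) x *\<^sub>R (\<bar>w x\<bar> * K))"
      by (intro borel_integrable_compact continuous_intros continuous_on_subset[OF w]) auto
    have "(\<lambda>n. (\<phi> (x - ?h n *\<^sub>R ?e) - \<phi> x) * real (Suc n)) \<longlonglongrightarrow> - partial_deriv i \<phi> x" for x
    proof -
      have "((\<lambda>t. \<phi> (x + t *\<^sub>R ?e)) has_real_derivative partial_deriv i \<phi> (x + 0 *\<^sub>R ?e)) (at 0)"
        by (rule DERIV_partial_deriv[OF test_function_differentiable[OF \<phi>]])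
      then have d: "((\<lambda>t. (\<phi> (x + t *\<^sub>R ?e) - \<phi> x) / t) \<longlongrightarrow> partial_deriv i \<phi> x) (at 0)"
        by (simp add: DERIV_def)
      have "(\<lambda>n. - ?h n) \<longlonglongrightarrow> - 0"
        by (intro tendsto_minus LIMSEQ_Suc[OF lim_1_over_n])
      then have "filterlim (\<lambda>n. - ?h n) (at 0) sequentially"
        unfolding filterlim_at by (auto simp del: of_nat_Suc)
      from tendsto_minus[OF filterlim_compose[OF d this]]
      have "(\<lambda>n. - ((\<phi> (x + (- ?h n) *\<^sub>R ?e) - \<phi> x) / (- ?h n))) \<longlonglongrightarrow> - partial_deriv i \<phi> x" .
      moreover have "- ((\<phi> (x + (- ?h n) *\<^sub>R ?e) - \<phi> x) / (- ?h n)) =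
          (\<phi> (x - ?h n *\<^sub>R ?e) - \<phi> x) * real (Suc n)" for n
        by (simp del: of_nat_Suc)
      ultimately show ?thesis by (simp only:)
    qed
    then show "AE x in lborel. (\<lambda>n. w x * ((\<phi> (x - ?h n *\<^sub>R ?e) - \<phi> x) * real (Suc n)))
        \<longlonglongrightarrow> w x * (- partial_deriv i \<phi> x)"
      by (intro AE_I2 tendsto_mult tendsto_const)
    have "\<bar>(\<phi> (x - ?h n *\<^sub>R ?e) - \<phi> x) * real (Suc n)\<bar> \<le> indicator (cball 0 (R + 1)) x * K" for n x
    proof (cases "norm x > R + 1")
      case True
      then show ?thesis using R[of x] R'[of x n] K(1) by simp
    next
      case False
      then show ?thesis
        using mult_right_mono[OF K(2)[OF h(1), of x n], of "real (Suc n)"]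
        by (simp add: abs_mult del: of_nat_Suc)
    qed
    from mult_left_mono[OF this abs_ge_zero]
    have "norm (w x * ((\<phi> (x - ?h n *\<^sub>R ?e) - \<phi> x) * real (Suc n)))
        \<le> \<bar>w x\<bar> * (indicator (cball 0 (R + 1)) x * K)" for n x
      by (simp only: real_norm_def abs_mult[of "w x"])
    also have "\<bar>w x\<bar> * (indicator (cball 0 (R + 1)) x * K) = indicator (cball 0 (R + 1)) x *\<^sub>R (\<bar>w x\<bar> * K)" for x
      by (simp only: real_scaleR_def mult.left_commute)
    finally show "AE x in lborel. norm (w x * ((\<phi> (x - ?h n *\<^sub>R ?e) - \<phi> x) * real (Suc n)))
        \<le> indicator (cball 0 (R + 1)) x *\<^sub>R (\<bar>w x\<bar> * K)" for n
      by (rule AE_I2)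
  qed measurable
  ultimately have "(\<integral>x. g x * \<phi> x \<partial>lborel) = (\<integral>x. w x * (- partial_deriv i \<phi> x) \<partial>lborel)"
    by (simp only: LIMSEQ_unique)
  then show "(\<integral>x. w x * partial_deriv i \<phi> x \<partial>lborel) = - (\<integral>x. g x * \<phi> x \<partial>lborel)"
    by simp
qed

subsection \<open>A lower bound for weak derivatives\<close>

abbreviation exp_flat :: "real \<Rightarrow> real" where "exp_flat \<equiv> flat 1"

abbreviation exp_flat_deriv :: "real \<Rightarrow> real" where "exp_flat_deriv \<equiv> flat [:0, 0, 1:]"

lemma DERIV_exp_flat: "(exp_flat has_real_derivative exp_flat_deriv t) (at t)"
  using DERIV_flat[of 1 t] by simp

lemma exp_flat_bounds: "0 \<le> exp_flat t" "exp_flat t \<le> 1"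
  by (auto simp: flat_def)

text \<open>The constant 2 comes from exp s >= 1 + s + s^2 / 2, which gives s^2 exp(-s) <=
  2.\<close>

lemma exp_flat_deriv_bounds: "0 \<le> exp_flat_deriv t" "exp_flat_deriv t \<le> 2"
proof -
  show "0 \<le> exp_flat_deriv t" by (auto simp: flat_def)
  have "s\<^sup>2 * exp (- s) \<le> 2" if "s > 0" for s :: real
    using exp_lower_Taylor_quadratic[of s] that by (simp add: exp_minus field_simps)
  from this[of "1 / t"] show "exp_flat_deriv t \<le> 2"
    by (auto simp: flat_def power2_eq_square)
qed

lemma exp_flat_ge: "exp_flat t \<ge> exp (- 4)" if "t \<ge> 1 / 4"
  using that by (auto simp: flat_def field_simps)

lemma exp_flat_deriv_ge: "exp_flat_deriv t \<ge> exp (- 4)" if "1 / 4 \<le> t" "t \<le> 1"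
proof -
  have "1 * exp (- 4) \<le> (1 / t * (1 / t)) * exp (- (1 / t))"
    using that by (intro mult_mono) (auto simp: field_simps mult_le_one)
  then show ?thesis
    using that by (simp add: flat_def)
qed

text \<open>
  The i-th factor rises on the scale \<open>\<epsilon>\<close> but decays on the scale 1, so the i-th partial
  derivative is of order \<open>1 / \<epsilon>\<close> near the point a and at least \<open>-2\<close> everywhere.
\<close>

definition tube_bump :: "'n \<Rightarrow> real \<Rightarrow> real ^ 'n \<Rightarrow> real ^ 'n::finite \<Rightarrow> real" where
  "tube_bump i \<epsilon> a x =
     exp_flat ((x $ i - a $ i) / \<epsilon>) * exp_flat (1 - (x $ i - a $ i)) *
     (\<Prod>j\<in>UNIV - {i}. exp_flat ((x $ j - a $ j) / \<epsilon>) * exp_flat (1 - (x $ j - a $ j) / \<epsilon>))"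

definition tube :: "'n \<Rightarrow> real \<Rightarrow> real ^ 'n \<Rightarrow> (real ^ 'n::finite) set" where
  "tube i \<epsilon> a = cbox a (a + (\<chi> j. if j = i then 1 else \<epsilon>))"

text \<open>The scaled coordinates lie in [1/4, 1/2]. Hence both they and their complements to 1 are
  at least 1/4, where the profile is bounded below, and adding a shift t < 1/2 does not change their
  integer parts, so half of the average defining \<open>kuhn\<close> sees the corner value.\<close>

definition quarter_cell :: "real \<Rightarrow> real ^ 'n \<Rightarrow> (real ^ 'n::finite) set" where
  "quarter_cell \<epsilon> a = cbox (a + (\<chi> j. \<epsilon> / 4)) (a + (\<chi> j. \<epsilon> / 2))"

lemma quarter_cell_subset_tube:
  assumes "0 < \<epsilon>" "\<epsilon> \<le> 1"
  shows "quarter_cell \<epsilon> a \<subseteq> tube i \<epsilon> a"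
proof
  fix x assume x: "x \<in> quarter_cell \<epsilon> a"
  have "a $ j \<le> x $ j \<and> x $ j \<le> a $ j + (if j = i then 1 else \<epsilon>)" for j
  proof -
    have "a $ j + \<epsilon> / 4 \<le> x $ j" "x $ j \<le> a $ j + \<epsilon> / 2"
      using x by (auto simp: quarter_cell_def mem_box_cart)
    then show ?thesis using assms by auto
  qed
  then show "x \<in> tube i \<epsilon> a" by (simp add: tube_def mem_box_cart)
qed

lemma measure_tube:
  fixes a :: "real ^ 'n::finite"
  assumes "\<epsilon> > 0"
  shows "measure lborel (tube i \<epsilon> a) = \<epsilon> ^ (CARD('n) - 1)"
proof -
  have "measure lborel (tube i \<epsilon> a) = (\<Prod>j\<in>UNIV. if j = i then 1 else \<epsilon>)"
    unfolding tube_def using assms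
    by (subst content_cbox_cart) (auto simp: interval_ne_empty_cart)
  also have "\<dots> = (\<Prod>j\<in>UNIV - {i}. \<epsilon>)"
    by (subst prod.remove[of _ i]) auto
  finally show ?thesis by (simp add: card_Diff_singleton)
qed

lemma measure_quarter_cell:
  fixes a :: "real ^ 'n::finite"
  assumes "\<epsilon> > 0"
  shows "measure lborel (quarter_cell \<epsilon> a) = (\<epsilon> / 4) ^ CARD('n)"
  unfolding quarter_cell_def using assms
  by (subst content_cbox_cart) (auto simp: interval_ne_empty_cart)

lemma tube_bump_zero: "\<epsilon> > 0 \<Longrightarrow> x \<notin> tube i \<epsilon> a \<Longrightarrow> tube_bump i \<epsilon> a x = 0"
proof -
  assume "\<epsilon> > 0" "x \<notin> tube i \<epsilon> a"
  then obtain j where j: "x $ j < a $ j \<or> x $ j > a $ j + (if j = i then 1 else \<epsilon>)"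
    unfolding tube_def mem_box_cart by (auto simp: not_le)
  show ?thesis
  proof (cases "j = i")
    case True
    then show ?thesis using j \<open>\<epsilon> > 0\<close>
      by (auto simp: tube_bump_def flat_def zero_less_divide_iff)
  next
    case False
    have "exp_flat ((x $ j - a $ j) / \<epsilon>) * exp_flat (1 - (x $ j - a $ j) / \<epsilon>) = 0"
      using j False \<open>\<epsilon> > 0\<close> by (auto simp: flat_def field_simps)
    then have "(\<Prod>j\<in>UNIV - {i}. exp_flat ((x $ j - a $ j) / \<epsilon>) * exp_flat (1 - (x $ j - a $ j) / \<epsilon>)) = 0"
      using False by (intro prod_zero) auto
    then show ?thesis by (simp add: tube_bump_def)
  qed
qed

lemma tube_bump_bounds: "0 \<le> tube_bump i \<epsilon> a x" "tube_bump i \<epsilon> a x \<le> 1"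
  unfolding tube_bump_def
  by (auto intro!: mult_nonneg_nonneg prod_nonneg mult_le_one prod_le_1 exp_flat_bounds)

lemma test_function_tube_bump:
  fixes a :: "real ^ 'n::finite"
  assumes "\<epsilon> > 0"
  shows "test_function (tube_bump i \<epsilon> a)"
  unfolding test_function_def
proof
  have c: "C_k k (\<lambda>x :: real ^ 'n. exp_flat ((x $ j - a $ j) / \<epsilon>))"
    "C_k k (\<lambda>x :: real ^ 'n. exp_flat (1 - (x $ j - a $ j) / \<epsilon>))"
    "C_k k (\<lambda>x :: real ^ 'n. exp_flat (1 - (x $ j - a $ j)))" for j k
    using C_k_flat_coord[of k 1 "- a $ j / \<epsilon>" "1 / \<epsilon>" j]
      C_k_flat_coord[of k 1 "1 + a $ j / \<epsilon>" "- 1 / \<epsilon>" j] C_k_flat_coord[of k 1 "1 + a $ j" "- 1" j]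
    by (simp_all add: diff_divide_distrib algebra_simps)
  show "\<forall>k. C_k k (tube_bump i \<epsilon> a)"
    unfolding tube_bump_def[abs_def] by (intro allI C_k_mult C_k_prod c)
  have "{x. tube_bump i \<epsilon> a x \<noteq> 0} \<subseteq> tube i \<epsilon> a"
    using tube_bump_zero[OF assms] by blast
  then have "bounded {x. tube_bump i \<epsilon> a x \<noteq> 0}"
    unfolding tube_def using bounded_cbox bounded_subset by blast
  then show "compact (closure {x. tube_bump i \<epsilon> a x \<noteq> 0})"
    by simp
qed

lemma partial_deriv_tube_bump:
  fixes a :: "real ^ 'n::finite"
  assumes "\<epsilon> > 0"
  shows "partial_deriv i (tube_bump i \<epsilon> a) x =
     (exp_flat_deriv ((x $ i - a $ i) / \<epsilon>) / \<epsilon> * exp_flat (1 - (x $ i - a $ i)) -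
      exp_flat ((x $ i - a $ i) / \<epsilon>) * exp_flat_deriv (1 - (x $ i - a $ i))) *
     (\<Prod>j\<in>UNIV - {i}. exp_flat ((x $ j - a $ j) / \<epsilon>) * exp_flat (1 - (x $ j - a $ j) / \<epsilon>))"
    (is "_ = ?D * ?P")
proof (rule partial_deriv_eq_DERIV[OF test_function_differentiable[OF test_function_tube_bump[OF assms]]])
  have P: "(\<Prod>j\<in>UNIV - {i}. exp_flat (((x + t *\<^sub>R axis i 1) $ j - a $ j) / \<epsilon>) *
      exp_flat (1 - ((x + t *\<^sub>R axis i 1) $ j - a $ j) / \<epsilon>)) = ?P" for t
    by (intro prod.cong) (auto simp: axis_def)
  show "((\<lambda>t. tube_bump i \<epsilon> a (x + t *\<^sub>R axis i 1)) has_real_derivative ?D * ?P) (at 0)"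
    unfolding tube_bump_def P using assms
    by (auto intro!: derivative_eq_intros DERIV_exp_flat[THEN DERIV_chain2] simp: field_simps)
qed

text \<open>A crude two-sided bound, of the size of the steep rise; it supplies integrability of w
  times this derivative and its vanishing outside the tube.\<close>

lemma abs_partial_deriv_tube_bump_le:
  fixes a :: "real ^ 'n::finite"
  assumes "0 < \<epsilon>"
  shows "\<bar>partial_deriv i (tube_bump i \<epsilon> a) x\<bar> \<le> (2 / \<epsilon> + 2) * indicator (tube i \<epsilon> a) x"
proof (cases "x \<in> tube i \<epsilon> a")
  case True
  let ?P = "\<Prod>j\<in>UNIV - {i}. exp_flat ((x $ j - a $ j) / \<epsilon>) * exp_flat (1 - (x $ j - a $ j) / \<epsilon>)"
  let ?z = "(x $ i - a $ i) / \<epsilon>" and ?t = "1 - (x $ i - a $ i)"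
  have P: "0 \<le> ?P" "?P \<le> 1"
    by (auto intro!: mult_nonneg_nonneg prod_nonneg mult_le_one prod_le_1 exp_flat_bounds)
  have "exp_flat_deriv ?z / \<epsilon> * exp_flat ?t \<le> 2 / \<epsilon> * 1"
    using assms by (intro mult_mono divide_right_mono exp_flat_bounds exp_flat_deriv_bounds) auto
  moreover have "0 \<le> exp_flat_deriv ?z / \<epsilon> * exp_flat ?t"
    using assms by (intro mult_nonneg_nonneg divide_nonneg_nonneg exp_flat_bounds exp_flat_deriv_bounds) auto
  moreover have "exp_flat ?z * exp_flat_deriv ?t \<le> 1 * 2"
    by (intro mult_mono exp_flat_bounds exp_flat_deriv_bounds) auto
  moreover have "0 \<le> exp_flat ?z * exp_flat_deriv ?t"
    by (intro mult_nonneg_nonneg exp_flat_bounds exp_flat_deriv_bounds)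
  ultimately have "\<bar>exp_flat_deriv ?z / \<epsilon> * exp_flat ?t - exp_flat ?z * exp_flat_deriv ?t\<bar> \<le> 2 / \<epsilon> + 2"
    by linarith
  with P have "\<bar>exp_flat_deriv ?z / \<epsilon> * exp_flat ?t - exp_flat ?z * exp_flat_deriv ?t\<bar> * \<bar>?P\<bar> \<le> (2 / \<epsilon> + 2) * 1"
    using assms by (intro mult_mono) auto
  then show ?thesis
    using True by (simp add: partial_deriv_tube_bump[OF assms] abs_mult)
next
  case False
  have "closed (tube i \<epsilon> a)" unfolding tube_def by (rule closed_cbox)
  from partial_deriv_eq_0_outside_closed[OF test_function_tube_bump[OF assms] this tube_bump_zero[OF assms] False]
  show ?thesis using False by simp
qed

text \<open>The product rule gives a nonnegative term from the steep rise and a negative one from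
  the slow decay. On the quarter cell each of the d coordinates contributes two profile values, or
  one value and one derivative, each at least exp(-4); this is the origin of exp(-8)^d. The decay
  term is at most 1 * 2 * 1 in size because its length scale is 1.\<close>

lemma partial_deriv_tube_bump_ge:
  fixes a :: "real ^ 'n::finite"
  assumes "0 < \<epsilon>" "\<epsilon> \<le> 1"
  shows "partial_deriv i (tube_bump i \<epsilon> a) x \<ge>
    exp (- 8) ^ CARD('n) / \<epsilon> * indicator (quarter_cell \<epsilon> a) x - 2 * indicator (tube i \<epsilon> a) x"
proof -
  let ?f = "\<lambda>j. exp_flat ((x $ j - a $ j) / \<epsilon>) * exp_flat (1 - (x $ j - a $ j) / \<epsilon>)"
  let ?P = "\<Prod>j\<in>UNIV - {i}. ?f j"
  let ?z = "(x $ i - a $ i) / \<epsilon>" and ?t = "1 - (x $ i - a $ i)"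
  have P: "0 \<le> ?P" "?P \<le> 1"
    by (auto intro!: mult_nonneg_nonneg prod_nonneg mult_le_one prod_le_1 exp_flat_bounds)
  have 1: "exp_flat_deriv ?z / \<epsilon> * exp_flat ?t * ?P \<ge> exp (- 8) ^ CARD('n) / \<epsilon> * indicator (quarter_cell \<epsilon> a) x"
  proof (cases "x \<in> quarter_cell \<epsilon> a")
    case True
    then have z: "1 / 4 \<le> (x $ j - a $ j) / \<epsilon>" "(x $ j - a $ j) / \<epsilon> \<le> 1 / 2" for j
      using assms by (auto simp: quarter_cell_def mem_box_cart field_simps)
    have t: "?t \<ge> 1 / 4"
      using z(2)[of i] assms by (simp add: field_simps)
    have "exp (- 8) \<le> ?f j" for j
    proof -
      have "1 / 4 \<le> 1 - (x $ j - a $ j) / \<epsilon>" using z(2)[of j] by linarith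
      have "exp (- 4) * exp (- 4) \<le> ?f j"
        using z[of j] by (intro mult_mono exp_flat_ge) (simp_all only: exp_flat_bounds exp_ge_zero)
      then show ?thesis by (simp add: exp_add[symmetric])
    qed
    then have "(\<Prod>j\<in>UNIV - {i}. exp (- 8)) \<le> ?P"
      by (intro prod_mono) auto
    moreover have "exp (- 4) * exp (- 4) \<le> exp_flat_deriv ?z * exp_flat ?t"
    proof (intro mult_mono exp_flat_ge exp_flat_deriv_ge t)
      show "?z \<le> 1" using z(2)[of i] by linarith
    qed (simp_all only: z exp_flat_deriv_bounds exp_ge_zero)
    then have "exp (- 8) \<le> exp_flat_deriv ?z * exp_flat ?t" by (simp add: exp_add[symmetric])
    ultimately have "exp (- 8) * exp (- 8) ^ (CARD('n) - 1) \<le> exp_flat_deriv ?z * exp_flat ?t * ?P"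
      by (intro mult_mono) (auto simp: card_Diff_singleton exp_flat_bounds exp_flat_deriv_bounds)
    then have "exp (- 8) ^ CARD('n) \<le> exp_flat_deriv ?z * exp_flat ?t * ?P"
      by (simp add: power_Suc[symmetric] del: power_Suc)
    then show ?thesis
      using True assms by (simp add: field_simps)
  next
    case False
    then show ?thesis
      using assms P by (auto intro!: mult_nonneg_nonneg divide_nonneg_nonneg simp: exp_flat_bounds exp_flat_deriv_bounds)
  qed
  show ?thesis
  proof (cases "x \<in> tube i \<epsilon> a")
    case True
    have "exp_flat ?z * exp_flat_deriv ?t * ?P \<le> 1 * 2 * 1"
      by (intro mult_mono mult_nonneg_nonneg P exp_flat_bounds exp_flat_deriv_bounds) auto
    then show ?thesis
      using 1 True unfolding partial_deriv_tube_bump[OF assms(1)] left_diff_distrib by simp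
  next
    case False
    then have "x \<notin> quarter_cell \<epsilon> a"
      using quarter_cell_subset_tube[OF assms] by blast
    then show ?thesis
      using abs_partial_deriv_tube_bump_le[OF assms(1), of i a x] False by simp
  qed
qed

lemma weighted_arith_geo_mean:
  fixes a b s :: real
  assumes "s > 0"
  shows "2 * (a * b) \<le> s * a\<^sup>2 + b\<^sup>2 / s"
proof -
  have "0 \<le> (s * a - b)\<^sup>2 / s" using assms by simp
  then show ?thesis using assms by (simp add: power2_diff power2_eq_square field_simps)
qed

text \<open>Cauchy-Schwarz over A in additive form. The weight s is later the square root of the
  measure of A, so that both terms on the right carry a factor s.\<close>

lemma square_integrable_times_indicator:
  fixes w :: "real ^ 'n::finite \<Rightarrow> real"
  assumes w: "square_integrable w" and A: "A \<in> sets lborel" "emeasure lborel A < \<infinity>" and s: "s > 0"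
  shows "integrable lborel (\<lambda>x. \<bar>w x\<bar> * indicator A x)"
    "2 * (\<integral>x. \<bar>w x\<bar> * indicator A x \<partial>lborel) \<le> s * (\<integral>x. (w x)\<^sup>2 \<partial>lborel) + measure lborel A / s"
proof -
  have [measurable]: "w \<in> borel_measurable lborel" and w2: "integrable lborel (\<lambda>x. (w x)\<^sup>2)"
    using w by (auto simp: square_integrable_def)
  note [measurable] = A(1)
  have iA: "integrable lborel (indicator A :: _ \<Rightarrow> real)"
    using A by simp
  have le: "2 * (\<bar>w x\<bar> * indicator A x) \<le> s * (w x)\<^sup>2 + indicator A x / s" for x
    using weighted_arith_geo_mean[OF s, of "\<bar>w x\<bar>" "indicator A x"] s
    by (cases "x \<in> A") simp_all
  have int: "integrable lborel (\<lambda>x. s * (w x)\<^sup>2 + indicator A x / s)"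
    using w2 iA by auto
  then have "integrable lborel (\<lambda>x. 2 * (\<bar>w x\<bar> * indicator A x))"
    by (rule Bochner_Integration.integrable_bound) (use le in \<open>auto intro!: AE_I2 simp: order_trans[OF le abs_ge_self]\<close>)
  then show i: "integrable lborel (\<lambda>x. \<bar>w x\<bar> * indicator A x)"
    by simp
  have "2 * (\<integral>x. \<bar>w x\<bar> * indicator A x \<partial>lborel) = (\<integral>x. 2 * (\<bar>w x\<bar> * indicator A x) \<partial>lborel)"
    by simp
  also have "\<dots> \<le> (\<integral>x. s * (w x)\<^sup>2 + indicator A x / s \<partial>lborel)"
    using i by (intro integral_mono int le) auto
  also have "\<dots> = s * (\<integral>x. (w x)\<^sup>2 \<partial>lborel) + measure lborel A / s"
    using w2 iA A by simp
  finally show "2 * (\<integral>x. \<bar>w x\<bar> * indicator A x \<partial>lborel) \<le> s * (\<integral>x. (w x)\<^sup>2 \<partial>lborel) + measure lborel A / s" .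
qed

text \<open>Test the weak derivative with the tube bump. The quarter cell contributes a gain of
  order m \<epsilon>^(d-1); the decay of the bump and the pairing with g cost integrals of w and |g|
  over the tube, each estimated by Cauchy-Schwarz. Since g is an arbitrary weak derivative, the
  bound applies to the one selected by \<open>weak_partial\<close>.\<close>

lemma weak_partial_lower_bound:
  fixes w g :: "real ^ 'n::finite \<Rightarrow> real"
  assumes w: "square_integrable w" "\<And>x. w x \<ge> 0" and g: "is_weak_partial i w g"
    and \<epsilon>: "0 < \<epsilon>" "\<epsilon> \<le> 1" and m: "0 \<le> m" "\<And>x. x \<in> quarter_cell \<epsilon> a \<Longrightarrow> m \<le> w x"
  shows "(exp (- 8) / 4) ^ CARD('n) * m * sqrt (\<epsilon> ^ (CARD('n) - 1)) \<le>
    (\<integral>x. (w x)\<^sup>2 \<partial>lborel) + (\<integral>x. (g x)\<^sup>2 \<partial>lborel) + 2"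
proof -
  let ?T = "tube i \<epsilon> a" and ?B = "quarter_cell \<epsilon> a" and ?\<phi> = "tube_bump i \<epsilon> a"
  let ?c = "exp (- 8) ^ CARD('n) :: real"
  \<comment> \<open>The square root of the volume of the tube; the whole inequality is divided by s
    once at the end.\<close>
  define s where "s = sqrt (\<epsilon> ^ (CARD('n) - 1))"
  have s: "s > 0" "s * s = \<epsilon> ^ (CARD('n) - 1)" using \<epsilon> by (auto simp: s_def)
  have gs: "square_integrable g" using g by (simp add: is_weak_partial_def)
  have wm [measurable]: "w \<in> borel_measurable borel" and gm [measurable]: "g \<in> borel_measurable borel"
    using w gs by (auto simp: square_integrable_def)
  note test = test_function_tube_bump[OF \<epsilon>(1), of i a]
  have \<phi>m [measurable]: "?\<phi> \<in> borel_measurable borel"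
    using test_function_continuous[OF test] by (rule borel_measurable_continuous_onI)
  have dm [measurable]: "partial_deriv i ?\<phi> \<in> borel_measurable borel"
    using test_function_continuous_partial[OF test] by (rule borel_measurable_continuous_onI)
  have T: "?T \<in> sets lborel" "emeasure lborel ?T < \<infinity>" and B: "?B \<in> sets lborel" "emeasure lborel ?B < \<infinity>"
    unfolding tube_def quarter_cell_def using emeasure_lborel_cbox_finite by auto
  note [measurable] = T(1) B(1)
  note wT = square_integrable_times_indicator[OF w(1) T s(1)]
  note gT = square_integrable_times_indicator[OF gs T s(1)]
  note wB = square_integrable_times_indicator(1)[OF w(1) B s(1)]
  have mT: "measure lborel ?T / s = s" using s by (simp add: measure_tube[OF \<epsilon>(1)] field_simps)
  have d: "(\<integral>x. w x * partial_deriv i ?\<phi> x \<partial>lborel) = - (\<integral>x. g x * ?\<phi> x \<partial>lborel)"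
    using g test by (auto simp: is_weak_partial_def)
  have g\<phi>: "\<bar>g x * ?\<phi> x\<bar> \<le> \<bar>g x\<bar> * indicator ?T x" for x
    using tube_bump_zero[OF \<epsilon>(1), of x i a] tube_bump_bounds[of i \<epsilon> a x]
    by (cases "x \<in> ?T") (auto simp: abs_mult mult_left_le)
  have ig: "integrable lborel (\<lambda>x. g x * ?\<phi> x)"
    by (rule Bochner_Integration.integrable_bound[OF gT(1)]) (use g\<phi> in \<open>auto intro!: AE_I2\<close>)
  have "- (\<integral>x. g x * ?\<phi> x \<partial>lborel) = (\<integral>x. - (g x * ?\<phi> x) \<partial>lborel)" by simp
  also have "\<dots> \<le> (\<integral>x. \<bar>g x\<bar> * indicator ?T x \<partial>lborel)"
    using ig gT(1) by (intro integral_mono) (use g\<phi> abs_le_D2 in auto)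
  finally have up: "- (\<integral>x. g x * ?\<phi> x \<partial>lborel) \<le> (\<integral>x. \<bar>g x\<bar> * indicator ?T x \<partial>lborel)" .
  have low: "?c / \<epsilon> * m * (\<epsilon> / 4) ^ CARD('n) - 2 * (\<integral>x. \<bar>w x\<bar> * indicator ?T x \<partial>lborel)
      \<le> (\<integral>x. w x * partial_deriv i ?\<phi> x \<partial>lborel)"
  proof -
    have pt: "(?c / \<epsilon> * m) * indicator ?B x - 2 * (\<bar>w x\<bar> * indicator ?T x) \<le> w x * partial_deriv i ?\<phi> x" for x
    proof -
      have "w x * (?c / \<epsilon> * indicator ?B x - 2 * indicator ?T x) \<le> w x * partial_deriv i ?\<phi> x"
        by (intro mult_left_mono partial_deriv_tube_bump_ge \<epsilon> w)
      moreover have "(?c / \<epsilon> * m) * indicator ?B x \<le> (?c / \<epsilon> * w x) * indicator ?B x"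
        using m \<epsilon> by (auto simp: indicator_def field_simps)
      ultimately show ?thesis
        using w(2)[of x] by (simp add: algebra_simps)
    qed
    have "integrable lborel (\<lambda>x. w x * partial_deriv i ?\<phi> x)"
    proof (rule Bochner_Integration.integrable_bound)
      show "integrable lborel (\<lambda>x. (2 / \<epsilon> + 2) * (\<bar>w x\<bar> * indicator ?T x))"
        using wT(1) by simp
      have "\<bar>w x\<bar> * \<bar>partial_deriv i ?\<phi> x\<bar> \<le> \<bar>w x\<bar> * ((2 / \<epsilon> + 2) * indicator ?T x)" for x
        by (intro mult_left_mono abs_partial_deriv_tube_bump_le \<epsilon>) auto
      then show "AE x in lborel. norm (w x * partial_deriv i ?\<phi> x) \<le> norm ((2 / \<epsilon> + 2) * (\<bar>w x\<bar> * indicator ?T x))"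
        using \<epsilon> by (intro AE_I2) (simp add: abs_mult mult_ac)
    qed measurable
    moreover have iB: "integrable lborel (indicator ?B :: _ \<Rightarrow> real)"
      using B by simp
    ultimately have "(\<integral>x. (?c / \<epsilon> * m) * indicator ?B x - 2 * (\<bar>w x\<bar> * indicator ?T x) \<partial>lborel)
      \<le> (\<integral>x. w x * partial_deriv i ?\<phi> x \<partial>lborel)"
      using wT(1) by (intro integral_mono pt) auto
    also have "(\<integral>x. (?c / \<epsilon> * m) * indicator ?B x - 2 * (\<bar>w x\<bar> * indicator ?T x) \<partial>lborel) =
      ?c / \<epsilon> * m * measure lborel ?B - 2 * (\<integral>x. \<bar>w x\<bar> * indicator ?T x \<partial>lborel)"
      using wT(1) iB by (subst Bochner_Integration.integral_diff) auto
    finally show ?thesis by (simp add: measure_quarter_cell[OF \<epsilon>(1)])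
  qed
  \<comment> \<open>The slope 1/\<epsilon> of the bump removes one power of \<epsilon> from the
    volume of the quarter cell, leaving exactly the volume s * s of the tube.\<close>
  have "?c / \<epsilon> * m * (\<epsilon> / 4) ^ CARD('n) = (exp (- 8) / 4) ^ CARD('n) * m * (s * s)"
    using \<epsilon> unfolding s(2) power_divide
    by (simp add: power_eq_if field_simps)
  note eq = this
  \<comment> \<open>The collected estimates with the integrals abstracted to variables, as a purely
    linear statement.\<close>
  have arith: "A - 2 * W1 \<le> D \<Longrightarrow> - G \<le> G1 \<Longrightarrow> D = - G \<Longrightarrow> 2 * W1 \<le> W2 + k \<Longrightarrow>
      2 * G1 \<le> G2 + k \<Longrightarrow> k = s \<Longrightarrow> A = A' \<Longrightarrow> A' \<le> W2 + s + (G2 + s) / 2"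
    for A A' D G G1 G2 W1 W2 k :: real
    by argo
  have "(exp (- 8) / 4) ^ CARD('n) * m * (s * s) \<le>
      s * (\<integral>x. (w x)\<^sup>2 \<partial>lborel) + s + (s * (\<integral>x. (g x)\<^sup>2 \<partial>lborel) + s) / 2"
    by (rule arith[OF low up d wT(2) gT(2) mT eq])
  then have "s * ((exp (- 8) / 4) ^ CARD('n) * m * s) \<le>
      s * ((\<integral>x. (w x)\<^sup>2 \<partial>lborel) + 1 + ((\<integral>x. (g x)\<^sup>2 \<partial>lborel) + 1) / 2)"
    by (simp add: algebra_simps)
  then have "(exp (- 8) / 4) ^ CARD('n) * m * s \<le>
      (\<integral>x. (w x)\<^sup>2 \<partial>lborel) + 1 + ((\<integral>x. (g x)\<^sup>2 \<partial>lborel) + 1) / 2"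
    using s(1) by (simp only: mult_le_cancel_left_pos)
  moreover have "(\<integral>x. (g x)\<^sup>2 \<partial>lborel) \<ge> 0" by simp
  ultimately show ?thesis unfolding s_def by argo
qed

subsection \<open>The interpolation as an average of step functions\<close>

definition lattice_floor :: "real \<Rightarrow> real ^ 'n::finite \<Rightarrow> real \<Rightarrow> int ^ 'n" where
  "lattice_floor \<epsilon> x t = (\<chi> i. \<lfloor>x $ i / \<epsilon> + t\<rfloor>)"

text \<open>
  The interpolation over the triangulation into the simplices of \<^const>\<open>cell_simplex\<close>
  is the Lovasz extension on each cube; averaging over diagonal shifts writes it without reference
  to the simplices.
\<close>

definition kuhn :: "real \<Rightarrow> (real ^ 'n::finite \<Rightarrow> real) \<Rightarrow> real ^ 'n \<Rightarrow> real" where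
  "kuhn \<epsilon> u x = (\<integral>t. indicator {0..<1} t * u (lattice_point \<epsilon> (lattice_floor \<epsilon> x t)) \<partial>lborel)"

definition lattice_bounded :: "real \<Rightarrow> (real ^ 'n::finite \<Rightarrow> real) \<Rightarrow> bool" where
  "lattice_bounded \<epsilon> u \<longleftrightarrow> (\<exists>B. \<forall>k. \<bar>u (lattice_point \<epsilon> k)\<bar> \<le> B)"

lemma measurable_vec_floor:
  fixes f :: "'n::finite \<Rightarrow> 'a \<Rightarrow> real"
  assumes [measurable]: "\<And>i. f i \<in> borel_measurable M"
  shows "(\<lambda>z. \<chi> i. \<lfloor>f i z\<rfloor>) \<in> M \<rightarrow>\<^sub>M count_space UNIV"
  unfolding measurable_count_space_eq2_countable
proof (intro conjI ballI)
  fix k :: "int ^ 'n"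
  have "(\<lambda>z. \<chi> i. \<lfloor>f i z\<rfloor>) -` {k} \<inter> space M = {z \<in> space M. \<forall>i. of_int (k $ i) \<le> f i z \<and> f i z < of_int (k $ i) + 1}"
    by (auto simp: vec_eq_iff floor_eq_iff)
  also have "\<dots> \<in> sets M" by measurable
  finally show "(\<lambda>z. \<chi> i. \<lfloor>f i z\<rfloor>) -` {k} \<inter> space M \<in> sets M" .
qed simp

lemma measurable_lattice_floor_t: "(\<lambda>t. G (lattice_floor \<epsilon> x t)) \<in> borel_measurable borel"
proof (rule measurable_compose[where f = "lattice_floor \<epsilon> x" and N = "count_space UNIV" and g = G])
  show "lattice_floor \<epsilon> x \<in> borel \<rightarrow>\<^sub>M count_space UNIV"
    unfolding lattice_floor_def[abs_def] by (rule measurable_vec_floor) measurable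
qed simp

lemma measurable_lattice_floor: "(\<lambda>x. lattice_floor \<epsilon> x t) \<in> borel \<rightarrow>\<^sub>M count_space UNIV"
  unfolding lattice_floor_def by (rule measurable_vec_floor) measurable

lemma integrable_bounded_indicator:
  fixes f :: "real \<Rightarrow> real"
  assumes [measurable]: "f \<in> borel_measurable borel" and "\<And>t. 0 \<le> t \<Longrightarrow> t < 1 \<Longrightarrow> \<bar>f t\<bar> \<le> B"
  shows "integrable lborel (\<lambda>t. indicator {0..<1} t * f t)"
proof (rule Bochner_Integration.integrable_bound)
  show "integrable lborel (\<lambda>t. indicator {0..<1 :: real} t * \<bar>B\<bar>)" by simp
  have "norm (indicator {0..<1} t * f t) \<le> norm (indicator {0..<1} t * \<bar>B\<bar>)" for t
    using assms(2)[of t] by (auto simp: indicator_def)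
  then show "AE t in lborel. norm (indicator {0..<1} t * f t) \<le> norm (indicator {0..<1} t * \<bar>B\<bar>)" by simp
qed measurable

lemma integral_step:
  fixes s :: real
  assumes "0 \<le> s" "s \<le> 1"
  shows "integrable lborel (\<lambda>t. indicator {0..<1} t * of_bool (1 \<le> s + t) :: real)"
    "(\<integral>t. indicator {0..<1} t * of_bool (1 \<le> s + t) \<partial>lborel) = s"
proof -
  have eq: "(\<lambda>t. indicator {0..<1} t * of_bool (1 \<le> s + t) :: real) = indicator {1 - s..<1}"
    using assms by (auto simp: fun_eq_iff indicator_def)
  show "integrable lborel (\<lambda>t. indicator {0..<1} t * of_bool (1 \<le> s + t) :: real)"
    "(\<integral>t. indicator {0..<1} t * of_bool (1 \<le> s + t) \<partial>lborel) = s"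
    unfolding eq using assms by auto
qed

text \<open>The upper end s = k + 1 is allowed: the indicator is then 1 for every t. Formulas
  derived from this hold on closed simplices and so agree on common faces.\<close>

lemma floor_add_eq_of_bool:
  fixes s t :: real
  assumes "0 \<le> t" "t < 1" "of_int k \<le> s" "s \<le> of_int k + 1"
  shows "\<lfloor>s + t\<rfloor> = k + of_bool (1 \<le> (s - of_int k) + t)"
  using assms by (auto simp: floor_eq_iff)

lemma integral_floor:
  fixes s :: real
  shows "integrable lborel (\<lambda>t. indicator {0..<1} t * of_int \<lfloor>s + t\<rfloor> :: real)"
    "(\<integral>t. indicator {0..<1} t * of_int \<lfloor>s + t\<rfloor> \<partial>lborel) = s"
proof -
  let ?k = "\<lfloor>s\<rfloor>"
  have s: "0 \<le> s - of_int ?k" "s - of_int ?k \<le> 1" by linarith+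
  have eq: "(\<lambda>t. indicator {0..<1} t * of_int \<lfloor>s + t\<rfloor> :: real) =
      (\<lambda>t. indicator {0..<1} t * of_int ?k + indicator {0..<1} t * of_bool (1 \<le> (s - of_int ?k) + t))"
    using floor_add_eq_of_bool[of _ ?k s] s by (auto simp: fun_eq_iff indicator_def)
  show "integrable lborel (\<lambda>t. indicator {0..<1} t * of_int \<lfloor>s + t\<rfloor> :: real)"
    unfolding eq by (intro Bochner_Integration.integrable_add integral_step[OF s]) auto
  show "(\<integral>t. indicator {0..<1} t * of_int \<lfloor>s + t\<rfloor> \<partial>lborel) = s"
    unfolding eq
    by (subst Bochner_Integration.integral_add[OF _ integral_step(1)[OF s]]) (auto simp: integral_step(2)[OF s])
qed

lemma integrable_kuhn:
  fixes u :: "real ^ 'n::finite \<Rightarrow> real"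
  assumes "\<And>t. 0 \<le> t \<Longrightarrow> t < 1 \<Longrightarrow> \<bar>u (lattice_point \<epsilon> (lattice_floor \<epsilon> x t))\<bar> \<le> B"
  shows "integrable lborel (\<lambda>t. indicator {0..<1} t * u (lattice_point \<epsilon> (lattice_floor \<epsilon> x t)))"
  using assms by (intro integrable_bounded_indicator[where B = B]
    measurable_lattice_floor_t[where G = "\<lambda>k. u (lattice_point \<epsilon> k)"]) auto

text \<open>The bound B concerns only the nodal values that the average at x uses. It can therefore
  depend on x, as with \<open>cell_sq_sum\<close> below, where a global supremum would not be square
  integrable.\<close>

lemma abs_kuhn_le:
  assumes "\<And>t. 0 \<le> t \<Longrightarrow> t < 1 \<Longrightarrow> \<bar>u (lattice_point \<epsilon> (lattice_floor \<epsilon> x t))\<bar> \<le> B"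
  shows "\<bar>kuhn \<epsilon> u x\<bar> \<le> B"
proof -
  let ?f = "\<lambda>t. indicator {0..<1} t * u (lattice_point \<epsilon> (lattice_floor \<epsilon> x t))"
  have le: "\<bar>?f t\<bar> \<le> indicator {0..<1} t * B" for t
    using assms[of t] by (cases "t \<in> {0..<1}") auto
  have "\<bar>kuhn \<epsilon> u x\<bar> \<le> (\<integral>t. \<bar>?f t\<bar> \<partial>lborel)"
    unfolding kuhn_def by (rule integral_abs_bound)
  also have "\<dots> \<le> (\<integral>t. indicator {0..<1} t * B \<partial>(lborel :: real measure))"
    by (intro integral_mono le integrable_abs integrable_kuhn[of u \<epsilon> x, OF assms]) auto
  finally show ?thesis by simp
qed

text \<open>
  The step function changes only for those shifts t where \<open>\<lfloor>x\<^sub>i / \<epsilon> + t\<rfloor>\<close> jumps, and the mean of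
  \<open>\<lfloor>s + t\<rfloor>\<close> over t is s.
\<close>

lemma kuhn_diff_le:
  fixes x :: "real ^ 'n::finite"
  assumes \<epsilon>: "\<epsilon> > 0" and h: "h \<ge> 0"
    and B: "\<And>t. 0 \<le> t \<Longrightarrow> t < 1 \<Longrightarrow> \<bar>u (lattice_point \<epsilon> (lattice_floor \<epsilon> x t))\<bar> \<le> B"
      "\<And>t. 0 \<le> t \<Longrightarrow> t < 1 \<Longrightarrow> \<bar>u (lattice_point \<epsilon> (lattice_floor \<epsilon> (x + h *\<^sub>R axis i 1) t))\<bar> \<le> B"
  shows "\<bar>kuhn \<epsilon> u (x + h *\<^sub>R axis i 1) - kuhn \<epsilon> u x\<bar> \<le> 2 * B / \<epsilon> * h"
proof -
  let ?u = "\<lambda>x t. u (lattice_point \<epsilon> (lattice_floor \<epsilon> x t))" and ?y = "x + h *\<^sub>R axis i 1"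
  let ?I = "indicator {0..<1} :: real \<Rightarrow> real"
  have int: "integrable lborel (\<lambda>t. ?I t * ?u ?y t)" "integrable lborel (\<lambda>t. ?I t * ?u x t)"
    by (rule integrable_kuhn[where B = B], use B in auto)+
  have le: "\<bar>?I t * ?u ?y t - ?I t * ?u x t\<bar> \<le>
      2 * B * (?I t * of_int \<lfloor>?y $ i / \<epsilon> + t\<rfloor> - ?I t * of_int \<lfloor>x $ i / \<epsilon> + t\<rfloor>)" for t
  proof (cases "0 \<le> t \<and> t < 1")
    case True
    have mono: "\<lfloor>x $ i / \<epsilon> + t\<rfloor> \<le> \<lfloor>?y $ i / \<epsilon> + t\<rfloor>"
      using \<epsilon> h by (intro floor_mono) (simp add: divide_right_mono)
    have B0: "B \<ge> 0" using B(1)[of t] True by auto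
    show ?thesis
    proof (cases "\<lfloor>x $ i / \<epsilon> + t\<rfloor> = \<lfloor>?y $ i / \<epsilon> + t\<rfloor>")
      case eq: True
      then have "lattice_floor \<epsilon> ?y t = lattice_floor \<epsilon> x t"
        by (auto simp: lattice_floor_def vec_eq_iff axis_def)
      then show ?thesis using eq by simp
    next
      case False
      then have "(1 :: real) \<le> of_int \<lfloor>?y $ i / \<epsilon> + t\<rfloor> - of_int \<lfloor>x $ i / \<epsilon> + t\<rfloor>"
        using mono by linarith
      then have "2 * B * 1 \<le> 2 * B * (of_int \<lfloor>?y $ i / \<epsilon> + t\<rfloor> - of_int \<lfloor>x $ i / \<epsilon> + t\<rfloor>)"
        using B0 by (intro mult_left_mono) auto
      moreover have "\<bar>?u ?y t - ?u x t\<bar> \<le> 2 * B"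
        using B(1)[of t] B(2)[of t] True by linarith
      ultimately show ?thesis
        using True by simp
    qed
  qed simp
  have "\<bar>kuhn \<epsilon> u ?y - kuhn \<epsilon> u x\<bar> = \<bar>\<integral>t. ?I t * ?u ?y t - ?I t * ?u x t \<partial>lborel\<bar>"
    unfolding kuhn_def using Bochner_Integration.integral_diff[OF int] by simp
  also have "\<dots> \<le> (\<integral>t. \<bar>?I t * ?u ?y t - ?I t * ?u x t\<bar> \<partial>lborel)"
    by (rule integral_abs_bound)
  also have "\<dots> \<le> (\<integral>t. 2 * B * (?I t * of_int \<lfloor>?y $ i / \<epsilon> + t\<rfloor> - ?I t * of_int \<lfloor>x $ i / \<epsilon> + t\<rfloor>) \<partial>lborel)"
    by (intro integral_mono integrable_abs Bochner_Integration.integrable_diff int le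
        integrable_mult_right integral_floor)
  also have "\<dots> = 2 * B * (?y $ i / \<epsilon> - x $ i / \<epsilon>)"
    by (subst integral_mult_right_zero, subst Bochner_Integration.integral_diff) (simp_all only: integral_floor)
  also have "\<dots> = 2 * B / \<epsilon> * h"
    by (simp add: diff_divide_distrib[symmetric])
  finally show ?thesis .
qed

lemma lattice_floor_lattice_point:
  assumes "\<epsilon> > 0" "0 \<le> t" "t < 1"
  shows "lattice_floor \<epsilon> (lattice_point \<epsilon> k) t = k"
  using assms by (auto simp: lattice_floor_def lattice_point_def vec_eq_iff floor_eq_iff)

lemma kuhn_lattice_point:
  assumes "\<epsilon> > 0"
  shows "kuhn \<epsilon> u (lattice_point \<epsilon> k) = u (lattice_point \<epsilon> k)"
proof -
  have "kuhn \<epsilon> u (lattice_point \<epsilon> k) = (\<integral>t. indicator {0..<1} t * u (lattice_point \<epsilon> k) \<partial>(lborel :: real measure))"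
    unfolding kuhn_def using lattice_floor_lattice_point[OF assms, of _ k]
    by (intro Bochner_Integration.integral_cong refl) (auto simp: indicator_def)
  then show ?thesis by simp
qed

section \<open>Identification of the average with the piecewise-affine interpolation\<close>

lemma simplex_vertex_eq_lattice_point:
  "simplex_vertex \<epsilon> k \<sigma> r = lattice_point \<epsilon> (k + (\<Sum>j\<in>{1..r}. axis (\<sigma> j) 1))"
proof -
  have "of_int (axis (\<sigma> j) 1 $ i) = (axis (\<sigma> j) 1 $ i :: real)" for i j
    by (simp add: axis_def)
  then show ?thesis
    by (simp add: simplex_vertex_def lattice_point_def vec_eq_iff sum_component of_int_sum algebra_simps)
qed

text \<open>For a fixed shift t the coordinates whose integer part is raised are those with y + t >=
  1. As y decreases along \<sigma>, they form an initial segment of the ordering, so the step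
  function takes its value at a vertex of the simplex. Telescoping along the vertices and
  integrating over t replaces each indicator by the corresponding coordinate of y.\<close>

lemma kuhn_on_simplex:
  fixes y :: "real ^ 'n::finite"
  assumes \<epsilon>: "\<epsilon> > 0" and \<sigma>: "coord_order \<sigma>"
    and y01: "\<And>i. 0 \<le> y $ i" "\<And>i. y $ i \<le> 1"
    and ord: "\<And>i j. 1 \<le> i \<Longrightarrow> i \<le> j \<Longrightarrow> j \<le> CARD('n) \<Longrightarrow> y $ \<sigma> j \<le> y $ \<sigma> i"
  shows "kuhn \<epsilon> u (lattice_point \<epsilon> k + \<epsilon> *\<^sub>R y) = u (simplex_vertex \<epsilon> k \<sigma> 0) +
    (\<Sum>r = 1..CARD('n). y $ \<sigma> r * (u (simplex_vertex \<epsilon> k \<sigma> r) - u (simplex_vertex \<epsilon> k \<sigma> (r - 1))))"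
proof -
  let ?x = "lattice_point \<epsilon> k + \<epsilon> *\<^sub>R y" and ?d = "CARD('n)"
  let ?v = "\<lambda>r. u (simplex_vertex \<epsilon> k \<sigma> r)"
  let ?I = "indicator {0..<1} :: real \<Rightarrow> real"
  have bij: "bij_betw \<sigma> {1..?d} UNIV" using \<sigma> by (simp add: coord_order_def)
  have pt: "u (lattice_point \<epsilon> (lattice_floor \<epsilon> ?x t)) =
      ?v 0 + (\<Sum>r = 1..?d. of_bool (1 \<le> y $ \<sigma> r + t) * (?v r - ?v (r - 1)))" if t: "0 \<le> t" "t < 1" for t
  proof -
    define A where "A = {r \<in> {1..?d}. 1 \<le> y $ \<sigma> r + t}"
    \<comment> \<open>The number of raised coordinates; inserting 0 covers the case where none is
      raised, which gives the vertex with index 0.\<close>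
    define R where "R = Max (insert 0 A)"
    have fin: "finite (insert 0 A)" by (simp add: A_def)
    have RA: "R \<in> insert 0 A" unfolding R_def using fin by (intro Max_in) auto
    have A_eq: "A = {1..R}"
    proof (intro equalityI subsetI)
      fix r assume "r \<in> A"
      then show "r \<in> {1..R}" using Max_ge[OF fin, of r] by (auto simp: A_def R_def)
    next
      fix r assume r: "r \<in> {1..R}"
      then have "R \<in> A" using RA by auto
      then show "r \<in> A" using r ord[of r R] by (auto simp: A_def)
    qed
    have Rd: "R \<le> ?d" using RA by (auto simp: A_def)
    have "lattice_floor \<epsilon> ?x t = k + (\<Sum>j\<in>{1..R}. axis (\<sigma> j) 1)"
    proof (subst vec_eq_iff, intro allI)
      fix i
      have "i \<in> \<sigma> ` {1..?d}" using bij by (simp add: bij_betw_def)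
      then obtain r where r: "r \<in> {1..?d}" "\<sigma> r = i" by blast
      have "?x $ i / \<epsilon> = of_int (k $ i) + y $ i"
        using \<epsilon> by (simp add: lattice_point_def add_divide_distrib)
      then have "lattice_floor \<epsilon> ?x t $ i = k $ i + of_bool (1 \<le> y $ i + t)"
        using floor_add_eq_of_bool[OF t, of "k $ i" "of_int (k $ i) + y $ i"] y01
        by (simp add: lattice_floor_def)
      also have "1 \<le> y $ i + t \<longleftrightarrow> r \<in> A" using r by (simp add: A_def)
      also have "of_bool (r \<in> A) = (\<Sum>j\<in>A. of_bool (j = r) :: int)"
        using fin by (simp add: of_bool_def)
      also have "\<dots> = (\<Sum>j\<in>A. axis (\<sigma> j) 1 $ i)"
      proof (intro sum.cong refl)
        fix j assume "j \<in> A"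
        then have "j \<in> {1..?d}" by (simp add: A_def)
        then have "\<sigma> j = i \<longleftrightarrow> j = r"
          using bij r by (metis bij_betw_imp_inj_on inj_on_eq_iff)
        then show "of_bool (j = r) = (axis (\<sigma> j) 1 $ i :: int)" by (auto simp: axis_def)
      qed
      finally show "lattice_floor \<epsilon> ?x t $ i = (k + (\<Sum>j\<in>{1..R}. axis (\<sigma> j) 1)) $ i"
        by (simp add: A_eq sum_component)
    qed
    then have "u (lattice_point \<epsilon> (lattice_floor \<epsilon> ?x t)) = ?v R"
      by (simp add: simplex_vertex_eq_lattice_point)
    also have "\<dots> = ?v 0 + (\<Sum>r = 1..R. ?v r - ?v (r - 1))"
      by (induction R) auto
    also have "(\<Sum>r = 1..R. ?v r - ?v (r - 1)) = (\<Sum>r = 1..?d. of_bool (1 \<le> y $ \<sigma> r + t) * (?v r - ?v (r - 1)))"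
      unfolding A_eq[symmetric] by (intro sum.mono_neutral_cong_left) (auto simp: A_def)
    finally show ?thesis .
  qed
  have "kuhn \<epsilon> u ?x = (\<integral>t. ?I t * ?v 0 + (\<Sum>r = 1..?d. (?I t * of_bool (1 \<le> y $ \<sigma> r + t)) * (?v r - ?v (r - 1))) \<partial>lborel)"
    unfolding kuhn_def using pt
    by (intro Bochner_Integration.integral_cong refl) (auto simp: indicator_def)
  also have "\<dots> = ?v 0 + (\<Sum>r = 1..?d. y $ \<sigma> r * (?v r - ?v (r - 1)))"
    using integral_step[OF y01(1) y01(2)]
    by (subst Bochner_Integration.integral_add) (auto simp: integral_step[OF y01(1) y01(2)])
  finally show ?thesis .
qed

lemma exists_coord_order:
  fixes y :: "real ^ 'n::finite"
  obtains \<sigma> where "coord_order \<sigma>"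
    "\<And>i j. 1 \<le> i \<Longrightarrow> i \<le> j \<Longrightarrow> j \<le> CARD('n) \<Longrightarrow> y $ \<sigma> j \<le> y $ \<sigma> i"
proof -
  obtain xs0 :: "'n list" where xs0: "set xs0 = UNIV" "distinct xs0"
    using finite_distinct_list[of "UNIV :: 'n set"] by auto
  \<comment> \<open>Negated keys sort the coordinates in decreasing order; list positions start at
    0, while \<open>coord_order\<close> counts from 1.\<close>
  define xs where "xs = sort_key (\<lambda>i. - (y $ i)) xs0"
  have xs: "distinct xs" "set xs = UNIV" "sorted (map (\<lambda>i. - (y $ i)) xs)"
    using xs0 by (simp_all add: xs_def)
  have len: "length xs = CARD('n)"
    using distinct_card[OF xs(1)] xs(2) by simp
  define \<sigma> where "\<sigma> r = xs ! (r - 1)" for r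
  have "bij_betw (\<lambda>r. r - 1) {1..CARD('n)} {..<CARD('n)}"
    by (rule bij_betwI[where g = Suc]) auto
  from bij_betw_trans[OF this bij_betw_nth[OF xs(1), of _ UNIV]]
  have "bij_betw ((!) xs \<circ> (\<lambda>r. r - 1)) {1..CARD('n)} UNIV"
    using xs(2) len by simp
  then have "coord_order \<sigma>"
    unfolding coord_order_def \<sigma>_def[abs_def] comp_def .
  moreover have "y $ \<sigma> j \<le> y $ \<sigma> i" if "1 \<le> i" "i \<le> j" "j \<le> CARD('n)" for i j
    using sorted_nth_mono[OF xs(3), of "i - 1" "j - 1"] that len by (simp add: \<sigma>_def)
  ultimately show ?thesis by (rule that)
qed

text \<open>Exhibits the simplex as an affine image of a reference simplex cut out by linear
  inequalities, from which convexity is immediate.\<close>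

lemma cell_simplex_alt:
  assumes "coord_order (\<sigma> :: nat \<Rightarrow> 'n::finite)"
  shows "cell_simplex \<epsilon> k \<sigma> = (\<lambda>y. lattice_point \<epsilon> k + \<epsilon> *\<^sub>R y) `
    {y. (\<forall>i. 0 \<le> y $ i \<and> y $ i \<le> 1) \<and>
      (\<forall>i j. 1 \<le> i \<longrightarrow> i \<le> j \<longrightarrow> j \<le> CARD('n) \<longrightarrow> y $ \<sigma> j \<le> y $ \<sigma> i)}"
proof -
  have im: "\<sigma> ` {1..CARD('n)} = UNIV"
    using assms by (simp add: coord_order_def bij_betw_def)
  have all: "(\<forall>j\<in>{1..CARD('n)}. P (\<sigma> j)) \<longleftrightarrow> (\<forall>i. P i)" for P
    by (metis im UNIV_I image_iff)
  have "(\<forall>i\<in>{1..CARD('n)}. \<forall>j\<in>{1..CARD('n)}. i \<le> j \<longrightarrow> y $ \<sigma> j \<le> y $ \<sigma> i) \<longleftrightarrow>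
      (\<forall>i j. 1 \<le> i \<longrightarrow> i \<le> j \<longrightarrow> j \<le> CARD('n) \<longrightarrow> y $ \<sigma> j \<le> y $ \<sigma> i)" for y :: "real ^ 'n"
    by auto
  then show ?thesis
    unfolding cell_simplex_def all[where P = "\<lambda>i. 0 \<le> _ $ i \<and> _ $ i \<le> 1"] by blast
qed

lemma exists_cell_simplex:
  fixes x :: "real ^ 'n::finite"
  assumes "\<epsilon> > 0"
  obtains k \<sigma> where "coord_order \<sigma>" "x \<in> cell_simplex \<epsilon> k \<sigma>"
proof -
  define k where "k = lattice_floor \<epsilon> x 0"
  define y where "y = (\<chi> i. x $ i / \<epsilon> - of_int (k $ i))"
  obtain \<sigma> where \<sigma>: "coord_order \<sigma>"
    "\<And>i j. 1 \<le> i \<Longrightarrow> i \<le> j \<Longrightarrow> j \<le> CARD('n) \<Longrightarrow> y $ \<sigma> j \<le> y $ \<sigma> i"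
    using exists_coord_order[of y] by blast
  have "0 \<le> y $ i" "y $ i \<le> 1" for i
    by (simp_all add: y_def k_def lattice_floor_def) linarith
  moreover have "x = lattice_point \<epsilon> k + \<epsilon> *\<^sub>R y"
    using assms by (simp add: vec_eq_iff y_def lattice_point_def field_simps)
  ultimately have "x \<in> cell_simplex \<epsilon> k \<sigma>"
    unfolding cell_simplex_alt[OF \<sigma>(1)] using \<sigma>(2) by blast
  with \<sigma>(1) show ?thesis by (rule that)
qed

lemma convex_cell_simplex:
  assumes "coord_order (\<sigma> :: nat \<Rightarrow> 'n::finite)"
  shows "convex (cell_simplex \<epsilon> k \<sigma>)"
proof -
  have "convex {y :: real ^ 'n. (\<forall>i. 0 \<le> y $ i \<and> y $ i \<le> 1) \<and>
      (\<forall>i j. 1 \<le> i \<longrightarrow> i \<le> j \<longrightarrow> j \<le> CARD('n) \<longrightarrow> y $ \<sigma> j \<le> y $ \<sigma> i)}"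
    by (rule convexI) (auto intro!: convex_bound_le add_mono mult_left_mono)
  then show ?thesis
    unfolding cell_simplex_alt[OF assms] by (rule convex_affinity)
qed

lemma vec_eq_sum_coord_order:
  fixes y :: "real ^ 'n::finite"
  assumes "coord_order \<sigma>"
  shows "y = (\<Sum>r = 1..CARD('n). y $ \<sigma> r *\<^sub>R axis (\<sigma> r) 1)"
proof -
  have "y = (\<Sum>i\<in>UNIV. y $ i *\<^sub>R axis i 1)"
    using basis_expansion[of y] by (simp add: scalar_mult_eq_scaleR)
  also have "\<dots> = (\<Sum>r = 1..CARD('n). y $ \<sigma> r *\<^sub>R axis (\<sigma> r) 1)"
    using assms unfolding coord_order_def by (intro sum.reindex_bij_betw[symmetric])
  finally show ?thesis .
qed

text \<open>Consecutive vertices differ by \<epsilon> times one basis vector, so the nodal values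
  determine the gradient and the constant of the affine function. The right-hand side is the one of
  \<open>kuhn_on_simplex\<close>; equality of the two functions follows.\<close>

lemma affine_interpolation_on_simplex:
  fixes y :: "real ^ 'n::finite"
  assumes w: "affine_interpolation \<epsilon> u w" and \<sigma>: "coord_order \<sigma>"
    and y01: "\<And>i. 0 \<le> y $ i" "\<And>i. y $ i \<le> 1"
    and ord: "\<And>i j. 1 \<le> i \<Longrightarrow> i \<le> j \<Longrightarrow> j \<le> CARD('n) \<Longrightarrow> y $ \<sigma> j \<le> y $ \<sigma> i"
  shows "w (lattice_point \<epsilon> k + \<epsilon> *\<^sub>R y) = u (simplex_vertex \<epsilon> k \<sigma> 0) +
    (\<Sum>r = 1..CARD('n). y $ \<sigma> r * (u (simplex_vertex \<epsilon> k \<sigma> r) - u (simplex_vertex \<epsilon> k \<sigma> (r - 1))))"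
proof -
  let ?v = "simplex_vertex \<epsilon> k \<sigma>" and ?d = "CARD('n)"
  obtain a b where ab: "\<And>x. x \<in> cell_simplex \<epsilon> k \<sigma> \<Longrightarrow> w x = a \<bullet> x + b"
    and wv: "\<And>r. r \<le> ?d \<Longrightarrow> w (?v r) = u (?v r)"
    using w \<sigma> unfolding affine_interpolation_def by blast
  have inj: "inj_on \<sigma> {1..?d}" using \<sigma> by (simp add: coord_order_def bij_betw_def)
  have v_in: "?v r \<in> cell_simplex \<epsilon> k \<sigma>" if r: "r \<le> ?d" for r
  proof -
    have c: "(\<Sum>j\<in>{1..r}. axis (\<sigma> j) (1 :: real)) $ \<sigma> m = of_bool (m \<le> r)" if "m \<in> {1..?d}" for m
    proof -
      have "(\<Sum>j\<in>{1..r}. axis (\<sigma> j) (1 :: real)) $ \<sigma> m = (\<Sum>j\<in>{1..r}. if j = m then 1 else 0)"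
        unfolding sum_component
      proof (intro sum.cong refl)
        fix j assume "j \<in> {1..r}"
        then have "j \<in> {1..?d}" using r by simp
        then have "\<sigma> j = \<sigma> m \<longleftrightarrow> j = m"
          using inj_on_eq_iff[OF inj] that by blast
        then show "axis (\<sigma> j) 1 $ \<sigma> m = (if j = m then 1 else 0 :: real)" by (auto simp: axis_def)
      qed
      then show ?thesis using that by simp
    qed
    then show ?thesis
      unfolding cell_simplex_def simplex_vertex_def
      by (intro CollectI exI[of _ "\<Sum>j\<in>{1..r}. axis (\<sigma> j) (1 :: real)"]) (auto simp: of_bool_def)
  qed
  have val: "a \<bullet> ?v r + b = u (?v r)" if "r \<le> ?d" for r
    using ab[OF v_in[OF that]] wv[OF that] by simp
  have diff: "\<epsilon> * (a \<bullet> axis (\<sigma> r) 1) = u (?v r) - u (?v (r - 1))" if "r \<in> {1..?d}" for r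
  proof -
    have "?v r = ?v (r - 1) + \<epsilon> *\<^sub>R axis (\<sigma> r) 1"
      using that by (cases r) (simp_all add: simplex_vertex_def scaleR_add_right)
    then have "a \<bullet> ?v r = a \<bullet> ?v (r - 1) + \<epsilon> * (a \<bullet> axis (\<sigma> r) 1)"
      by (simp add: inner_add_right)
    moreover have "a \<bullet> ?v r + b = u (?v r)" "a \<bullet> ?v (r - 1) + b = u (?v (r - 1))"
      using that by (auto intro!: val)
    ultimately show ?thesis by linarith
  qed
  have "lattice_point \<epsilon> k + \<epsilon> *\<^sub>R y \<in> cell_simplex \<epsilon> k \<sigma>"
    unfolding cell_simplex_alt[OF \<sigma>] using y01 ord by blast
  then have "w (lattice_point \<epsilon> k + \<epsilon> *\<^sub>R y) = a \<bullet> lattice_point \<epsilon> k + b + \<epsilon> * (a \<bullet> y)"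
    using ab by (simp add: inner_add_right)
  also have "a \<bullet> lattice_point \<epsilon> k + b = u (?v 0)"
    using val[of 0] by (simp add: simplex_vertex_def)
  also have "\<epsilon> * (a \<bullet> y) = (\<Sum>r = 1..?d. y $ \<sigma> r * (\<epsilon> * (a \<bullet> axis (\<sigma> r) 1)))"
    by (subst (1) vec_eq_sum_coord_order[OF \<sigma>, of y]) (simp add: inner_sum_right sum_distrib_left mult_ac)
  also have "\<dots> = (\<Sum>r = 1..?d. y $ \<sigma> r * (u (?v r) - u (?v (r - 1))))"
    by (intro sum.cong refl) (simp add: diff)
  finally show ?thesis .
qed

text \<open>For fixed t the integrand is locally constant near a unless some a_i / \<epsilon> + t is
  an integer. This excludes only countably many t, and dominated convergence applies.\<close>

lemma continuous_on_kuhn: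
  fixes u :: "real ^ 'n::finite \<Rightarrow> real"
  assumes \<epsilon>: "\<epsilon> > 0" and "lattice_bounded \<epsilon> u"
  shows "continuous_on UNIV (kuhn \<epsilon> u)"
  unfolding continuous_on_sequentially
proof (intro allI ballI impI)
  fix X :: "nat \<Rightarrow> real ^ 'n" and a
  assume X: "(\<forall>n. X n \<in> UNIV) \<and> X \<longlonglongrightarrow> a"
  obtain B where B: "\<And>k. \<bar>u (lattice_point \<epsilon> k)\<bar> \<le> B"
    using assms(2) by (auto simp: lattice_bounded_def)
  have "(\<lambda>n. kuhn \<epsilon> u (X n)) \<longlonglongrightarrow> kuhn \<epsilon> u a"
    unfolding kuhn_def
  proof (rule integral_dominated_convergence[where w = "\<lambda>t. indicator {0..<1} t * B"])
    have [measurable]: "(\<lambda>t. u (lattice_point \<epsilon> (lattice_floor \<epsilon> x t))) \<in> borel_measurable borel" for x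
      by (rule measurable_lattice_floor_t[where G = "\<lambda>k. u (lattice_point \<epsilon> k)"])
    show "(\<lambda>t. indicator {0..<1} t * u (lattice_point \<epsilon> (lattice_floor \<epsilon> a t))) \<in> borel_measurable lborel"
      "(\<lambda>t. indicator {0..<1} t * u (lattice_point \<epsilon> (lattice_floor \<epsilon> (X n) t))) \<in> borel_measurable lborel" for n
      by measurable
    show "integrable lborel (\<lambda>t. indicator {0..<1 :: real} t * B)" by simp
    have "norm (indicator {0..<1} t * u (lattice_point \<epsilon> (lattice_floor \<epsilon> (X n) t))) \<le> indicator {0..<1} t * B" for t n
      using B by (cases "t \<in> {0..<1}") auto
    then show "AE t in lborel. norm (indicator {0..<1} t * u (lattice_point \<epsilon> (lattice_floor \<epsilon> (X n) t)))
        \<le> indicator {0..<1} t * B" for n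
      by (rule AE_I2)
    define N where "N = (\<Union>i. (\<lambda>m :: int. of_int m - a $ i / \<epsilon>) ` UNIV)"
    have "countable N" by (simp add: N_def)
    then have "AE t in lborel. t \<notin> N"
      by (intro AE_not_in countable_imp_null_set_lborel)
    then show "AE t in lborel. (\<lambda>n. indicator {0..<1} t * u (lattice_point \<epsilon> (lattice_floor \<epsilon> (X n) t)))
        \<longlonglongrightarrow> indicator {0..<1} t * u (lattice_point \<epsilon> (lattice_floor \<epsilon> a t))"
    proof eventually_elim
      fix t assume t: "t \<notin> N"
      have "\<forall>\<^sub>F n in sequentially. \<lfloor>X n $ i / \<epsilon> + t\<rfloor> = \<lfloor>a $ i / \<epsilon> + t\<rfloor>" for i
      proof (rule eventually_floor_eq)
        show "(\<lambda>n. X n $ i / \<epsilon> + t) \<longlonglongrightarrow> a $ i / \<epsilon> + t"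
          using X \<epsilon> by (intro tendsto_intros tendsto_vec_nth) auto
        show "a $ i / \<epsilon> + t \<notin> \<int>"
        proof
          assume "a $ i / \<epsilon> + t \<in> \<int>"
          then obtain m where "a $ i / \<epsilon> + t = of_int m" by (auto elim: Ints_cases)
          then have "t = of_int m - a $ i / \<epsilon>" by simp
          then show False using t by (auto simp: N_def)
        qed
      qed
      then have "\<forall>\<^sub>F n in sequentially. \<forall>i. \<lfloor>X n $ i / \<epsilon> + t\<rfloor> = \<lfloor>a $ i / \<epsilon> + t\<rfloor>"
        by (rule eventually_all_finite)
      then show "(\<lambda>n. indicator {0..<1} t * u (lattice_point \<epsilon> (lattice_floor \<epsilon> (X n) t)))
        \<longlonglongrightarrow> indicator {0..<1} t * u (lattice_point \<epsilon> (lattice_floor \<epsilon> a t))"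
        by (intro tendsto_eventually) (erule eventually_mono, simp add: lattice_floor_def)
    qed
  qed
  then show "(kuhn \<epsilon> u \<circ> X) \<longlonglongrightarrow> kuhn \<epsilon> u a" by (simp add: comp_def)
qed

lemma affine_interpolation_kuhn:
  fixes u :: "real ^ 'n::finite \<Rightarrow> real"
  assumes \<epsilon>: "\<epsilon> > 0" and "lattice_bounded \<epsilon> u"
  shows "affine_interpolation \<epsilon> u (kuhn \<epsilon> u)"
  unfolding affine_interpolation_def
proof (intro conjI allI impI)
  fix k and \<sigma> :: "nat \<Rightarrow> 'n"
  assume \<sigma>: "coord_order \<sigma>"
  let ?D = "\<lambda>r. u (simplex_vertex \<epsilon> k \<sigma> r) - u (simplex_vertex \<epsilon> k \<sigma> (r - 1))"
  define a where "a = (\<Sum>r = 1..CARD('n). (?D r / \<epsilon>) *\<^sub>R axis (\<sigma> r) (1 :: real))"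
  define b where "b = u (simplex_vertex \<epsilon> k \<sigma> 0) - a \<bullet> lattice_point \<epsilon> k"
  have "kuhn \<epsilon> u x = a \<bullet> x + b" if x: "x \<in> cell_simplex \<epsilon> k \<sigma>" for x
  proof -
    obtain y where y: "x = lattice_point \<epsilon> k + \<epsilon> *\<^sub>R y" "\<And>i. 0 \<le> y $ i" "\<And>i. y $ i \<le> 1"
      "\<And>i j. 1 \<le> i \<Longrightarrow> i \<le> j \<Longrightarrow> j \<le> CARD('n) \<Longrightarrow> y $ \<sigma> j \<le> y $ \<sigma> i"
      using x unfolding cell_simplex_alt[OF \<sigma>] by blast
    have "a \<bullet> (\<epsilon> *\<^sub>R y) = (\<Sum>r = 1..CARD('n). y $ \<sigma> r * ?D r)"
      using \<epsilon> by (simp add: a_def inner_sum_left sum_distrib_left inner_axis' mult.commute[of "y $ _"])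
    moreover have "kuhn \<epsilon> u x = u (simplex_vertex \<epsilon> k \<sigma> 0) + (\<Sum>r = 1..CARD('n). y $ \<sigma> r * ?D r)"
      unfolding y(1) by (rule kuhn_on_simplex[OF \<epsilon> \<sigma>]) (use y in blast)+
    ultimately show ?thesis
      by (simp add: b_def y(1) inner_add_right)
  qed
  then show "\<exists>a b. \<forall>x\<in>cell_simplex \<epsilon> k \<sigma>. kuhn \<epsilon> u x = a \<bullet> x + b" by blast
next
  fix k r and \<sigma> :: "nat \<Rightarrow> 'n"
  show "kuhn \<epsilon> u (simplex_vertex \<epsilon> k \<sigma> r) = u (simplex_vertex \<epsilon> k \<sigma> r)"
    unfolding simplex_vertex_eq_lattice_point by (rule kuhn_lattice_point[OF \<epsilon>])
qed (rule continuous_on_kuhn[OF assms])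

text \<open>The definite description needs existence and uniqueness. Uniqueness holds because the
  simplices cover the space and on each of them any interpolation is given by the same
  formula.\<close>

lemma extension_op_eq_kuhn:
  fixes u :: "real ^ 'n::finite \<Rightarrow> real"
  assumes \<epsilon>: "\<epsilon> > 0" and "lattice_bounded \<epsilon> u"
  shows "extension_op \<epsilon> u = kuhn \<epsilon> u"
  unfolding extension_op_def
proof (rule the_equality[where P = "affine_interpolation \<epsilon> u"])
  show "affine_interpolation \<epsilon> u (kuhn \<epsilon> u)"
    by (rule affine_interpolation_kuhn[OF assms])
next
  fix w assume w: "affine_interpolation \<epsilon> u w"
  show "w = kuhn \<epsilon> u"
  proof
    fix x :: "real ^ 'n"
    obtain k \<sigma> where \<sigma>: "coord_order \<sigma>" and x: "x \<in> cell_simplex \<epsilon> k \<sigma>"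
      using exists_cell_simplex[OF \<epsilon>] by blast
    obtain y where y: "x = lattice_point \<epsilon> k + \<epsilon> *\<^sub>R y" "\<And>i. 0 \<le> y $ i" "\<And>i. y $ i \<le> 1"
      "\<And>i j. 1 \<le> i \<Longrightarrow> i \<le> j \<Longrightarrow> j \<le> CARD('n) \<Longrightarrow> y $ \<sigma> j \<le> y $ \<sigma> i"
      using x unfolding cell_simplex_alt[OF \<sigma>] by blast
    show "w x = kuhn \<epsilon> u x"
      unfolding y(1)
    proof (rule trans)
      show "w (lattice_point \<epsilon> k + \<epsilon> *\<^sub>R y) = u (simplex_vertex \<epsilon> k \<sigma> 0) +
          (\<Sum>r = 1..CARD('n). y $ \<sigma> r * (u (simplex_vertex \<epsilon> k \<sigma> r) - u (simplex_vertex \<epsilon> k \<sigma> (r - 1))))"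
        by (rule affine_interpolation_on_simplex[OF w \<sigma>]) (use y in blast)+
      show "\<dots> = kuhn \<epsilon> u (lattice_point \<epsilon> k + \<epsilon> *\<^sub>R y)"
        by (rule kuhn_on_simplex[OF \<epsilon> \<sigma>, symmetric]) (use y in blast)+
    qed
  qed
qed

subsection \<open>Integrability and weak derivatives of the interpolation\<close>

lemma finite_vec_all_in:
  assumes "finite A"
  shows "finite {k :: 'a ^ 'n::finite. \<forall>i. k $ i \<in> A}"
proof (rule finite_subset)
  show "{k :: 'a ^ 'n. \<forall>i. k $ i \<in> A} \<subseteq> (\<lambda>f. \<chi> i. f i) ` (UNIV \<rightarrow>\<^sub>E A)"
  proof
    fix k :: "'a ^ 'n" assume "k \<in> {k. \<forall>i. k $ i \<in> A}"
    then have "(\<lambda>i. k $ i) \<in> UNIV \<rightarrow>\<^sub>E A" "k = (\<chi> i. k $ i)" by auto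
    then show "k \<in> (\<lambda>f. \<chi> i. f i) ` (UNIV \<rightarrow>\<^sub>E A)" by (intro image_eqI[of _ _ "\<lambda>i. k $ i"]) auto
  qed
  show "finite ((\<lambda>f. \<chi> i. f i) ` (UNIV \<rightarrow>\<^sub>E A) :: ('a ^ 'n) set)"
    using assms by (intro finite_imageI finite_PiE) auto
qed

lemma emeasure_lattice_cell_le:
  fixes k :: "int ^ 'n::finite"
  assumes "\<epsilon> > 0"
  shows "emeasure lborel {x. lattice_floor \<epsilon> x 0 = k} \<le> ennreal (\<epsilon> ^ CARD('n))"
proof -
  let ?C = "cbox (lattice_point \<epsilon> k) (lattice_point \<epsilon> k + (\<chi> i. \<epsilon>))"
  have "{x. lattice_floor \<epsilon> x 0 = k} \<subseteq> ?C"
  proof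
    fix x assume "x \<in> {x. lattice_floor \<epsilon> x 0 = k}"
    then have "of_int (k $ i) \<le> x $ i / \<epsilon>" "x $ i / \<epsilon> \<le> of_int (k $ i) + 1" for i
      by (auto simp: lattice_floor_def)
    then have "\<epsilon> * of_int (k $ i) \<le> x $ i" "x $ i \<le> \<epsilon> * of_int (k $ i) + \<epsilon>" for i
      using assms by (auto simp: field_simps)
    then show "x \<in> ?C" by (simp add: mem_box_cart lattice_point_def)
  qed
  then have "emeasure lborel {x. lattice_floor \<epsilon> x 0 = k} \<le> emeasure lborel ?C"
    by (rule emeasure_mono) simp
  also have "emeasure lborel ?C = ennreal (measure lborel ?C)"
    by (rule emeasure_eq_ennreal_measure) (use emeasure_lborel_cbox_finite in \<open>auto simp: less_top[symmetric]\<close>)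
  also have "measure lborel ?C = \<epsilon> ^ CARD('n)"
    using assms by (subst content_cbox_cart) (auto simp: interval_ne_empty_cart)
  finally show ?thesis .
qed

text \<open>The function is constant on each cell, so Tonelli's theorem turns its integral into a
  sum over cells, each of measure at most \<epsilon>^d.\<close>

lemma integrable_lattice_floor:
  fixes G :: "int ^ 'n::finite \<Rightarrow> real"
  assumes \<epsilon>: "\<epsilon> > 0" and G: "\<And>k. G k \<ge> 0" "G summable_on UNIV"
  shows "integrable lborel (\<lambda>x. G (lattice_floor \<epsilon> x 0))"
proof (rule integrableI_nonneg)
  let ?q = "\<lambda>x. lattice_floor \<epsilon> x 0"
  note q [measurable] = measurable_lattice_floor[where 'a = 'n, of \<epsilon> 0]
  show "(\<lambda>x. G (?q x)) \<in> borel_measurable lborel" by measurable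
  have "(\<integral>\<^sup>+x. G (?q x) \<partial>lborel) = (\<integral>\<^sup>+x. \<integral>\<^sup>+k. ennreal (G k) * indicator {x. ?q x = k} x \<partial>count_space UNIV \<partial>lborel)"
  proof (rule nn_integral_cong)
    fix x
    have "(\<integral>\<^sup>+k. ennreal (G k) * indicator {x. ?q x = k} x \<partial>count_space UNIV) =
        (\<integral>\<^sup>+k. ennreal (G k) * indicator {?q x} k \<partial>count_space UNIV)"
      by (rule nn_integral_cong) (auto simp: indicator_def)
    then show "ennreal (G (?q x)) = (\<integral>\<^sup>+k. ennreal (G k) * indicator {x. ?q x = k} x \<partial>count_space UNIV)"
      by simp
  qed
  also have "\<dots> = (\<integral>\<^sup>+k. \<integral>\<^sup>+x. ennreal (G k) * indicator {x. ?q x = k} x \<partial>lborel \<partial>count_space UNIV)"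
    by (rule nn_integral_count_space_nn_integral) auto
  also have "\<dots> = (\<integral>\<^sup>+k. ennreal (G k) * emeasure lborel {x. ?q x = k} \<partial>count_space UNIV)"
    by (intro nn_integral_cong nn_integral_cmult_indicator) auto
  also have "\<dots> \<le> (\<integral>\<^sup>+k. ennreal (G k) * ennreal (\<epsilon> ^ CARD('n)) \<partial>count_space UNIV)"
    by (intro nn_integral_mono mult_left_mono emeasure_lattice_cell_le \<epsilon>) auto
  also have "\<dots> = (\<integral>\<^sup>+k. ennreal (G k) \<partial>count_space UNIV) * ennreal (\<epsilon> ^ CARD('n))"
    by (rule nn_integral_multc) auto
  also have "\<dots> < \<infinity>"
  proof -
    have "Infinite_Set_Sum.abs_summable_on G UNIV"
      using G(2) summable_on_iff_abs_summable_on_real abs_summable_equivalent by blast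
    then have "integrable (count_space UNIV) G"
      by (simp add: abs_summable_on_def)
    then have "(\<integral>\<^sup>+k. ennreal (G k) \<partial>count_space UNIV) < \<infinity>"
      using G(1) by (simp add: integrable_iff_bounded)
    then show ?thesis by (simp add: ennreal_mult_less_top)
  qed
  finally show "(\<integral>\<^sup>+x. G (?q x) \<partial>lborel) < \<infinity>" .
qed (use G in auto)

text \<open>Sum of squares over the 2^d corners of the cell containing x. It is constant on cells,
  integrable when u is square summable, and its root bounds every nodal value entering the average
  at x; it serves as the common dominating function for w^2 and g^2.\<close>

definition cell_sq_sum :: "real \<Rightarrow> (real ^ 'n::finite \<Rightarrow> real) \<Rightarrow> real ^ 'n \<Rightarrow> real" where
  "cell_sq_sum \<epsilon> u x =
     (\<Sum>\<delta> | \<forall>i. \<delta> $ i \<in> {0, 1}. (u (lattice_point \<epsilon> (lattice_floor \<epsilon> x 0 + \<delta>)))\<^sup>2)"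

lemma cell_sq_sum_nonneg: "cell_sq_sum \<epsilon> u x \<ge> 0"
  unfolding cell_sq_sum_def by (rule sum_nonneg) simp

lemma integrable_cell_sq_sum:
  fixes u :: "real ^ 'n::finite \<Rightarrow> real"
  assumes \<epsilon>: "\<epsilon> > 0" and u: "(\<lambda>k. (u (lattice_point \<epsilon> k))\<^sup>2) summable_on UNIV"
  shows "integrable lborel (cell_sq_sum \<epsilon> u)"
  unfolding cell_sq_sum_def[abs_def]
proof (rule Bochner_Integration.integrable_sum)
  fix \<delta> :: "int ^ 'n"
  have "bij_betw (\<lambda>k. k + \<delta>) UNIV UNIV"
    by (rule bij_betwI[where g = "\<lambda>k. k - \<delta>"]) auto
  from summable_on_reindex_bij_betw[OF this, of "\<lambda>k. (u (lattice_point \<epsilon> k))\<^sup>2"] u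
  show "integrable lborel (\<lambda>x. (u (lattice_point \<epsilon> (lattice_floor \<epsilon> x 0 + \<delta>)))\<^sup>2)"
    by (intro integrable_lattice_floor[where G = "\<lambda>k. (u (lattice_point \<epsilon> (k + \<delta>)))\<^sup>2"] \<epsilon>) auto
qed

lemma abs_le_sqrt_cell_sq_sum:
  fixes u :: "real ^ 'n::finite \<Rightarrow> real"
  assumes "0 \<le> t" "t < 1"
  shows "\<bar>u (lattice_point \<epsilon> (lattice_floor \<epsilon> x t))\<bar> \<le> sqrt (cell_sq_sum \<epsilon> u x)"
proof -
  define \<delta> where "\<delta> = lattice_floor \<epsilon> x t - lattice_floor \<epsilon> x 0"
  have "\<delta> $ i \<in> {0, 1}" for i
  proof -
    have "\<lfloor>x $ i / \<epsilon>\<rfloor> \<le> \<lfloor>x $ i / \<epsilon> + t\<rfloor>" "\<lfloor>x $ i / \<epsilon> + t\<rfloor> < \<lfloor>x $ i / \<epsilon>\<rfloor> + 2"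
      using assms by linarith+
    then show ?thesis by (auto simp: \<delta>_def lattice_floor_def)
  qed
  moreover have "finite {\<delta> :: int ^ 'n. \<forall>i. \<delta> $ i \<in> {0, 1}}"
    by (rule finite_vec_all_in) simp
  ultimately have "(u (lattice_point \<epsilon> (lattice_floor \<epsilon> x 0 + \<delta>)))\<^sup>2 \<le> cell_sq_sum \<epsilon> u x"
    unfolding cell_sq_sum_def
    by (intro member_le_sum[where f = "\<lambda>\<delta>. (u (lattice_point \<epsilon> (lattice_floor \<epsilon> x 0 + \<delta>)))\<^sup>2"]) auto
  then show ?thesis
    by (intro real_le_rsqrt) (simp add: \<delta>_def)
qed

lemma summable_imp_lattice_bounded:
  fixes u :: "real ^ 'n::finite \<Rightarrow> real"
  assumes "(\<lambda>k. (u (lattice_point \<epsilon> k))\<^sup>2) summable_on UNIV"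
  shows "lattice_bounded \<epsilon> u"
proof -
  have "(u (lattice_point \<epsilon> k))\<^sup>2 \<le> (\<Sum>\<^sub>\<infinity>k. (u (lattice_point \<epsilon> k))\<^sup>2)" for k
    using finite_sum_le_infsum[OF assms, of "{k}"] by simp
  then have "\<bar>u (lattice_point \<epsilon> k)\<bar> \<le> sqrt (\<Sum>\<^sub>\<infinity>k. (u (lattice_point \<epsilon> k))\<^sup>2)" for k
    by (intro real_le_rsqrt) simp
  then show ?thesis by (auto simp: lattice_bounded_def)
qed

lemma square_integrable_of_bound:
  fixes w :: "real ^ 'n::finite \<Rightarrow> real"
  assumes "w \<in> borel_measurable borel" "integrable lborel Q" "AE x in lborel. (w x)\<^sup>2 \<le> Q x"
  shows "square_integrable w"
  unfolding square_integrable_def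
proof
  show "w \<in> borel_measurable lborel" using assms(1) by simp
  show "integrable lborel (\<lambda>x. (w x)\<^sup>2)"
  proof (rule Bochner_Integration.integrable_bound[OF assms(2)])
    show "(\<lambda>x. (w x)\<^sup>2) \<in> borel_measurable lborel" using assms(1) by simp
    show "AE x in lborel. norm ((w x)\<^sup>2) \<le> norm (Q x)"
      using assms(3) by eventually_elim auto
  qed
qed

lemma square_integrable_kuhn:
  fixes u :: "real ^ 'n::finite \<Rightarrow> real"
  assumes \<epsilon>: "\<epsilon> > 0" and u: "(\<lambda>k. (u (lattice_point \<epsilon> k))\<^sup>2) summable_on UNIV"
  shows "square_integrable (kuhn \<epsilon> u)"
proof (rule square_integrable_of_bound[OF _ integrable_cell_sq_sum[OF assms]])
  show "kuhn \<epsilon> u \<in> borel_measurable borel"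
    by (intro borel_measurable_continuous_onI continuous_on_kuhn \<epsilon> summable_imp_lattice_bounded u)
  have "(kuhn \<epsilon> u x)\<^sup>2 \<le> cell_sq_sum \<epsilon> u x" for x
  proof -
    have "\<bar>kuhn \<epsilon> u x\<bar> \<le> sqrt (cell_sq_sum \<epsilon> u x)"
      by (rule abs_kuhn_le) (rule abs_le_sqrt_cell_sq_sum)
    from power_mono[OF this abs_ge_zero, of 2] show ?thesis
      by (simp add: cell_sq_sum_nonneg)
  qed
  then show "AE x in lborel. (kuhn \<epsilon> u x)\<^sup>2 \<le> cell_sq_sum \<epsilon> u x" by simp
qed

text \<open>The simplices cover the space, are countable in number, and are convex, so the union of
  their frontiers is negligible.\<close>

lemma AE_interior_cell_simplex:
  assumes \<epsilon>: "\<epsilon> > 0"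
  shows "AE x :: real ^ 'n::finite in lborel. \<exists>k \<sigma>. coord_order \<sigma> \<and> x \<in> interior (cell_simplex \<epsilon> k \<sigma>)"
proof -
  define \<C> where "\<C> = {cell_simplex \<epsilon> k \<sigma> | k (\<sigma> :: nat \<Rightarrow> 'n). coord_order \<sigma>}"
  \<comment> \<open>The maps \<sigma> on all of nat need not form a countable set; only their values
    on {1..d} matter, which leaves finitely many for each k.\<close>
  have restrict: "cell_simplex \<epsilon> k (restrict \<sigma> {1..CARD('n)}) = cell_simplex \<epsilon> k \<sigma>" for k and \<sigma> :: "nat \<Rightarrow> 'n"
  proof -
    have "restrict \<sigma> {1..CARD('n)} j = \<sigma> j" if "j \<in> {1..CARD('n)}" for j
      using that by simp
    then show ?thesis
      unfolding cell_simplex_def by (simp only: cong: ball_cong)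
  qed
  have "\<C> \<subseteq> (\<lambda>(k, \<sigma>). cell_simplex \<epsilon> k \<sigma>) ` (UNIV \<times> ({1..CARD('n)} \<rightarrow>\<^sub>E UNIV))"
  proof
    fix S assume "S \<in> \<C>"
    then obtain k and \<sigma> :: "nat \<Rightarrow> 'n" where "S = cell_simplex \<epsilon> k \<sigma>" by (auto simp: \<C>_def)
    then have "S = (\<lambda>(k, \<sigma>). cell_simplex \<epsilon> k \<sigma>) (k, restrict \<sigma> {1..CARD('n)})"
      by (simp only: restrict prod.case)
    then show "S \<in> (\<lambda>(k, \<sigma>). cell_simplex \<epsilon> k \<sigma>) ` (UNIV \<times> ({1..CARD('n)} \<rightarrow>\<^sub>E UNIV))"
      by (rule image_eqI) auto
  qed
  moreover have "countable (UNIV \<times> ({1..CARD('n)} \<rightarrow>\<^sub>E UNIV) :: ((int ^ 'n) \<times> (nat \<Rightarrow> 'n)) set)"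
    by (intro countable_SIGMA countableI_type countable_finite finite_PiE) auto
  ultimately have "countable \<C>"
    using countable_subset countable_image by metis
  then have "negligible (\<Union> (frontier ` \<C>))"
    by (intro negligible_countable_Union) (auto simp: \<C>_def intro: negligible_convex_frontier convex_cell_simplex)
  then have "AE x in lebesgue. x \<notin> \<Union> (frontier ` \<C>)"
    unfolding negligible_iff_null_sets by (rule AE_not_in)
  then have "AE x in lborel. x \<notin> \<Union> (frontier ` \<C>)"
    by (simp add: AE_completion_iff)
  then show ?thesis
  proof eventually_elim
    fix x :: "real ^ 'n" assume x: "x \<notin> \<Union> (frontier ` \<C>)"
    obtain k \<sigma> where \<sigma>: "coord_order \<sigma>" "x \<in> cell_simplex \<epsilon> k \<sigma>"
      using exists_cell_simplex[OF \<epsilon>] by blast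
    then have "x \<notin> frontier (cell_simplex \<epsilon> k \<sigma>)"
      using x by (auto simp: \<C>_def)
    then have "x \<in> interior (cell_simplex \<epsilon> k \<sigma>)"
      using \<sigma>(2) closure_subset by (auto simp: frontier_def)
    then show "\<exists>k \<sigma>. coord_order \<sigma> \<and> x \<in> interior (cell_simplex \<epsilon> k \<sigma>)"
      using \<sigma>(1) by blast
  qed
qed

text \<open>Two different Lipschitz estimates are used. The global one, with the supremum of u,
  dominates the difference quotients; the local one, with \<open>cell_sq_sum\<close>, bounds their
  limit by a square integrable function.\<close>

lemma exists_weak_partial_kuhn:
  fixes u :: "real ^ 'n::finite \<Rightarrow> real"
  assumes \<epsilon>: "\<epsilon> > 0" and u: "(\<lambda>k. (u (lattice_point \<epsilon> k))\<^sup>2) summable_on UNIV"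
  shows "\<exists>g. is_weak_partial i (kuhn \<epsilon> u) g"
proof -
  let ?w = "kuhn \<epsilon> u"
  let ?q = "\<lambda>n x. (?w (x + (1 / real (Suc n)) *\<^sub>R axis i 1) - ?w x) * real (Suc n)"
  \<comment> \<open>Taking \<open>lim\<close> everywhere makes measurability automatic. Almost
    everywhere it is a component of the gradient of the affine piece containing x.\<close>
  define g where "g x = lim (\<lambda>n. ?q n x)" for x
  have bdd: "lattice_bounded \<epsilon> u" by (rule summable_imp_lattice_bounded[OF u])
  obtain B where B: "\<And>k. \<bar>u (lattice_point \<epsilon> k)\<bar> \<le> B"
    using bdd by (auto simp: lattice_bounded_def)
  have cont: "continuous_on UNIV ?w" by (rule continuous_on_kuhn[OF \<epsilon> bdd])
  then have wm: "?w \<in> borel_measurable borel"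
    by (rule borel_measurable_continuous_onI)
  have gm: "g \<in> borel_measurable borel"
  proof -
    have "(\<lambda>x. ?w (x + c)) \<in> borel_measurable borel" for c
      by (rule measurable_compose[OF _ wm]) measurable
    then show ?thesis
      unfolding g_def[abs_def] using wm
      by (intro borel_measurable_lim_metric borel_measurable_times borel_measurable_diff) auto
  qed
  have shift: "(\<lambda>n. x + (1 / real (Suc n)) *\<^sub>R axis i 1) \<longlonglongrightarrow> x" for x :: "real ^ 'n"
  proof -
    have "(\<lambda>n. x + (1 / real (Suc n)) *\<^sub>R axis i 1) \<longlonglongrightarrow> x + 0 *\<^sub>R axis i 1"
      by (intro tendsto_intros LIMSEQ_Suc[OF lim_1_over_n])
    then show ?thesis by simp
  qed
  have lim: "AE x in lborel. (\<lambda>n. ?q n x) \<longlonglongrightarrow> g x"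
    using AE_interior_cell_simplex[where 'n = 'n, OF \<epsilon>]
  proof eventually_elim
    fix x :: "real ^ 'n" assume "\<exists>k \<sigma>. coord_order \<sigma> \<and> x \<in> interior (cell_simplex \<epsilon> k \<sigma>)"
    then obtain k \<sigma> where \<sigma>: "coord_order \<sigma>" "x \<in> interior (cell_simplex \<epsilon> k \<sigma>)" by blast
    obtain a b where ab: "\<And>x. x \<in> cell_simplex \<epsilon> k \<sigma> \<Longrightarrow> ?w x = a \<bullet> x + b"
      using affine_interpolation_kuhn[OF \<epsilon> bdd] \<sigma>(1) unfolding affine_interpolation_def by blast
    have "\<forall>\<^sub>F n in sequentially. x + (1 / real (Suc n)) *\<^sub>R axis i 1 \<in> interior (cell_simplex \<epsilon> k \<sigma>)"
      using shift by (rule topological_tendstoD) (use \<sigma> in auto)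
    then have "\<forall>\<^sub>F n in sequentially. ?q n x = a \<bullet> axis i 1"
    proof eventually_elim
      case (elim n)
      then show ?case
        using ab[OF subsetD[OF interior_subset \<sigma>(2)]] ab[OF subsetD[OF interior_subset elim]]
        by (simp add: inner_add_right del: of_nat_Suc)
    qed
    then have "(\<lambda>n. ?q n x) \<longlonglongrightarrow> a \<bullet> axis i 1"
      by (rule tendsto_eventually)
    then show "(\<lambda>n. ?q n x) \<longlonglongrightarrow> g x"
      by (simp add: g_def limI del: of_nat_Suc)
  qed
  have gb: "AE x in lborel. (g x)\<^sup>2 \<le> (2 / \<epsilon>)\<^sup>2 * cell_sq_sum \<epsilon> u x"
    using lim
  proof eventually_elim
    fix x :: "real ^ 'n" assume x: "(\<lambda>n. ?q n x) \<longlonglongrightarrow> g x"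
    \<comment> \<open>A forward step that is small enough stays below the next grid hyperplane,
      since x is strictly below it. Both end points then lie in the same cell and share the same
      local bound.\<close>
    let ?S = "sqrt (cell_sq_sum \<epsilon> u x)"
    have "\<forall>\<^sub>F n in sequentially. 1 / real (Suc n) < \<epsilon> * (of_int (\<lfloor>x $ i / \<epsilon>\<rfloor> + 1) - x $ i / \<epsilon>)"
    proof (rule order_tendstoD(2)[OF LIMSEQ_Suc[OF lim_1_over_n]])
      have "0 < of_int (\<lfloor>x $ i / \<epsilon>\<rfloor> + 1) - x $ i / \<epsilon>" by linarith
      then show "0 < \<epsilon> * (of_int (\<lfloor>x $ i / \<epsilon>\<rfloor> + 1) - x $ i / \<epsilon>)"
        using \<epsilon> by simp
    qed
    then have "\<forall>\<^sub>F n in sequentially. \<bar>?q n x\<bar> \<le> 2 / \<epsilon> * ?S"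
    proof eventually_elim
      case (elim n)
      let ?h = "1 / real (Suc n)" and ?y = "x + (1 / real (Suc n)) *\<^sub>R axis i 1"
      have "?y $ i / \<epsilon> < of_int (\<lfloor>x $ i / \<epsilon>\<rfloor> + 1)"
      proof -
        have "?h / \<epsilon> < of_int (\<lfloor>x $ i / \<epsilon>\<rfloor> + 1) - x $ i / \<epsilon>"
          using elim \<epsilon> by (simp only: pos_divide_less_eq mult.commute)
        then show ?thesis by (simp add: add_divide_distrib del: of_nat_Suc)
      qed
      moreover have "x $ i / \<epsilon> \<le> ?y $ i / \<epsilon>"
        using \<epsilon> by (simp add: divide_right_mono del: of_nat_Suc)
      ultimately have "\<lfloor>?y $ i / \<epsilon>\<rfloor> = \<lfloor>x $ i / \<epsilon>\<rfloor>"
        by linarith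
      then have "lattice_floor \<epsilon> ?y 0 = lattice_floor \<epsilon> x 0"
        by (auto simp: lattice_floor_def vec_eq_iff axis_def)
      then have "cell_sq_sum \<epsilon> u ?y = cell_sq_sum \<epsilon> u x"
        by (simp add: cell_sq_sum_def)
      then have "\<bar>?w ?y - ?w x\<bar> \<le> 2 * ?S / \<epsilon> * ?h"
        using abs_le_sqrt_cell_sq_sum[of _ u \<epsilon> x] abs_le_sqrt_cell_sq_sum[of _ u \<epsilon> ?y]
        by (intro kuhn_diff_le \<epsilon>) (auto simp del: of_nat_Suc)
      from mult_right_mono[OF this, of "real (Suc n)"] show ?case
        by (simp add: abs_mult del: of_nat_Suc)
    qed
    then have "\<bar>g x\<bar> \<le> 2 / \<epsilon> * ?S"
      by (intro tendsto_upperbound[OF tendsto_rabs[OF x]]) auto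
    from power_mono[OF this abs_ge_zero, of 2]
    show "(g x)\<^sup>2 \<le> (2 / \<epsilon>)\<^sup>2 * cell_sq_sum \<epsilon> u x"
      by (simp add: power_mult_distrib power_divide cell_sq_sum_nonneg)
  qed
  have "square_integrable g"
    by (rule square_integrable_of_bound[OF gm _ gb]) (intro integrable_mult_right integrable_cell_sq_sum assms)
  moreover have "\<bar>?w (x + h *\<^sub>R axis i 1) - ?w x\<bar> \<le> 2 * B / \<epsilon> * h" if "0 \<le> h" for x h
    by (intro kuhn_diff_le \<epsilon> that B)
  ultimately have "is_weak_partial i ?w g"
    by (intro is_weak_partial_of_difference_quotient[where L = "2 * B / \<epsilon>"] cont lim)
  then show ?thesis by blast
qed

text \<open>Every shift t < 1/2 leaves x in the cell of k, so half of the average equals the value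
  at k, and the other half is nonnegative.\<close>

lemma kuhn_ge_on_quarter_cell:
  fixes u :: "real ^ 'n::finite \<Rightarrow> real"
  assumes \<epsilon>: "\<epsilon> > 0" and bdd: "lattice_bounded \<epsilon> u" and pos: "\<And>k. u (lattice_point \<epsilon> k) \<ge> 0"
  shows "kuhn \<epsilon> u x \<ge> 0"
    "x \<in> quarter_cell \<epsilon> (lattice_point \<epsilon> k) \<Longrightarrow> u (lattice_point \<epsilon> k) / 2 \<le> kuhn \<epsilon> u x"
proof -
  let ?f = "\<lambda>t. u (lattice_point \<epsilon> (lattice_floor \<epsilon> x t))"
  obtain B where B: "\<And>k. \<bar>u (lattice_point \<epsilon> k)\<bar> \<le> B"
    using bdd by (auto simp: lattice_bounded_def)
  show "kuhn \<epsilon> u x \<ge> 0"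
    unfolding kuhn_def by (rule Bochner_Integration.integral_nonneg) (simp add: pos)
  assume x: "x \<in> quarter_cell \<epsilon> (lattice_point \<epsilon> k)"
  have "indicator {0..<1 / 2} t * u (lattice_point \<epsilon> k) \<le> indicator {0..<1} t * ?f t" for t
  proof (cases "t \<in> {0..<1 / 2}")
    case True
    have "lattice_floor \<epsilon> x t = k"
    proof (simp only: lattice_floor_def vec_eq_iff vec_lambda_beta, intro allI)
      fix j
      have "\<epsilon> * of_int (k $ j) + \<epsilon> / 4 \<le> x $ j" "x $ j \<le> \<epsilon> * of_int (k $ j) + \<epsilon> / 2"
        using x by (auto simp: quarter_cell_def mem_box_cart lattice_point_def)
      then have "of_int (k $ j) + 1 / 4 \<le> x $ j / \<epsilon>" "x $ j / \<epsilon> \<le> of_int (k $ j) + 1 / 2"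
        using \<epsilon> by (simp_all add: field_simps)
      then show "\<lfloor>x $ j / \<epsilon> + t\<rfloor> = k $ j"
        using True unfolding floor_eq_iff by auto
    qed
    then show ?thesis using True by simp
  qed (simp add: pos)
  moreover have "integrable lborel (indicator {0..<c :: real} :: real \<Rightarrow> real)" if "c \<ge> 0" for c
    by (rule integrable_real_indicator) (use that in auto)
  from this[of "1 / 2"] have "integrable lborel (indicator {0..<1 / 2 :: real} :: real \<Rightarrow> real)"
    by linarith
  ultimately have "(\<integral>t. indicator {0..<1 / 2 :: real} t * u (lattice_point \<epsilon> k) \<partial>lborel) \<le> kuhn \<epsilon> u x"
    unfolding kuhn_def by (intro integral_mono integrable_kuhn[where B = B] B) auto
  then show "u (lattice_point \<epsilon> k) / 2 \<le> kuhn \<epsilon> u x" by simp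
qed

subsection \<open>Energy on the lattice\<close>

lemma infsum_abs_powr_nonneg:
  fixes u :: "real ^ 'n::finite \<Rightarrow> real"
  shows "0 \<le> (\<Sum>\<^sub>\<infinity>x\<in>lattice \<epsilon>. \<bar>u x\<bar> powr q)"
  by (rule infsum_nonneg) simp

lemma lq_norm_powr:
  assumes "q > 0"
  shows "lq_norm \<epsilon> q u powr q = (\<Sum>\<^sub>\<infinity>x\<in>lattice \<epsilon>. \<bar>u x\<bar> powr q)"
  using assms infsum_abs_powr_nonneg[of u q \<epsilon>] by (simp add: lq_norm_def powr_powr)

lemma lq_norm_2_power2: "(lq_norm \<epsilon> 2 u)\<^sup>2 = (\<Sum>\<^sub>\<infinity>x\<in>lattice \<epsilon>. \<bar>u x\<bar> powr 2)"
proof -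
  have "(lq_norm \<epsilon> 2 u)\<^sup>2 = lq_norm \<epsilon> 2 u powr 2"
    by (cases "lq_norm \<epsilon> 2 u = 0") (auto simp: lq_norm_def)
  then show ?thesis by (simp add: lq_norm_powr)
qed

lemma grad_norm_sq_nonneg: "\<epsilon> > 0 \<Longrightarrow> grad_norm_sq \<epsilon> u \<ge> 0"
  unfolding grad_norm_sq_def by (intro mult_nonneg_nonneg infsum_nonneg sum_nonneg) auto

section \<open>The comparison function and its energy\<close>

definition lattice_delta :: "real \<Rightarrow> real ^ 'n::finite \<Rightarrow> real" where
  "lattice_delta s x = (if x = 0 then s else 0)"

lemma zero_in_lattice: "0 \<in> lattice \<epsilon>"
proof -
  have "lattice_point \<epsilon> 0 = 0" by (simp add: lattice_point_def vec_eq_iff)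
  then show ?thesis unfolding lattice_def by (metis rangeI)
qed

lemma infsum_lattice_delta:
  assumes "s \<ge> 0"
  shows "(\<Sum>\<^sub>\<infinity>x\<in>(lattice \<epsilon> :: (real ^ 'n::finite) set). \<bar>lattice_delta s x\<bar> powr q) = s powr q"
proof -
  have "(\<Sum>\<^sub>\<infinity>x\<in>(lattice \<epsilon> :: (real ^ 'n) set). \<bar>lattice_delta s x\<bar> powr q) =
      (\<Sum>\<^sub>\<infinity>x\<in>{0 :: real ^ 'n}. \<bar>lattice_delta s x\<bar> powr q)"
    by (rule infsum_cong_neutral) (auto simp: lattice_delta_def zero_in_lattice)
  then show ?thesis using assms by (simp add: lattice_delta_def)
qed

lemma lattice_delta_in_mass:
  assumes "m \<ge> 0"
  shows "(lattice_delta (sqrt m) :: real ^ 'n::finite \<Rightarrow> real) \<in> lattice_H1_mass \<epsilon> m"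
proof -
  let ?u = "lattice_delta (sqrt m) :: real ^ 'n \<Rightarrow> real"
  have "finitely_supported \<epsilon> ?u"
    unfolding finitely_supported_def
    by (rule finite_subset[of _ "{0}"]) (auto simp: lattice_delta_def split: if_splits)
  moreover have "finite_lattice_H1_norm \<epsilon> (\<lambda>x. ?u x - ?u x)"
    by (simp add: finite_lattice_H1_norm_def)
  moreover have "lattice_H1_norm \<epsilon> (\<lambda>x. ?u x - ?u x) = 0"
    by (simp add: lattice_H1_norm_def grad_norm_sq_def lq_norm_def)
  ultimately have "?u \<in> lattice_H1 \<epsilon>"
    unfolding lattice_H1_def by (intro CollectI exI[of _ "\<lambda>_. ?u"]) simp
  moreover have "(lq_norm \<epsilon> 2 ?u)\<^sup>2 = m"
    unfolding lq_norm_2_power2 using assms by (subst infsum_lattice_delta) auto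
  ultimately show ?thesis by (simp add: lattice_H1_mass_def)
qed

text \<open>A crude enclosure of the neighbours of the origin. It also locates all points that have
  the origin as a neighbour, that is, where the gradient of the delta function can be
  nonzero.\<close>

lemma l1_norm_eq_mesh_imp_unit_offset:
  assumes "\<epsilon> > 0" "x \<in> lattice \<epsilon>" "(\<Sum>i\<in>UNIV. \<bar>x $ i\<bar>) = \<epsilon>"
  shows "x \<in> lattice_point \<epsilon> ` {k :: int ^ 'n::finite. \<forall>i. k $ i \<in> {-1, 0, 1}}"
proof -
  obtain k where k: "x = lattice_point \<epsilon> k" using assms(2) by (auto simp: lattice_def)
  have "k $ i \<in> {-1, 0, 1}" for i
  proof -
    have "\<bar>x $ i\<bar> \<le> (\<Sum>i\<in>UNIV. \<bar>x $ i\<bar>)"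
      by (rule member_le_sum) auto
    then have "\<epsilon> * \<bar>of_int (k $ i)\<bar> \<le> \<epsilon> * 1"
      using assms by (simp add: k lattice_point_def abs_mult)
    then have "\<bar>of_int (k $ i)\<bar> \<le> (1 :: real)"
      using assms(1) by (simp only: mult_le_cancel_left_pos)
    then have "\<bar>k $ i\<bar> \<le> 1" by linarith
    then show ?thesis by auto
  qed
  then show ?thesis using k by blast
qed

text \<open>What matters is that K depends on the dimension only. At most \<open>card Z\<close>
  points contribute, each at most \<open>card Z\<close> times s^2, where Z is the cube of offsets
  with entries -1, 0, 1.\<close>

lemma grad_norm_sq_lattice_delta_le:
  obtains K where "K > 0"
    "\<And>\<epsilon> s. \<epsilon> > 0 \<Longrightarrow> grad_norm_sq \<epsilon> (lattice_delta s :: real ^ 'n::finite \<Rightarrow> real) \<le> K * s\<^sup>2 / \<epsilon>"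
proof -
  define Z where "Z = {k :: int ^ 'n. \<forall>i. k $ i \<in> {-1, 0, 1}}"
  have fin: "finite Z" unfolding Z_def by (rule finite_vec_all_in) simp
  have "0 \<in> Z" by (simp add: Z_def)
  then have Z1: "1 \<le> real (card Z)" using fin by (metis One_nat_def Suc_leI card_gt_0_iff empty_iff of_nat_1 of_nat_mono)
  have "grad_norm_sq \<epsilon> (lattice_delta s :: real ^ 'n \<Rightarrow> real) \<le> ((real (card Z))\<^sup>2 / 2) * s\<^sup>2 / \<epsilon>"
    if \<epsilon>: "\<epsilon> > 0" for \<epsilon> s
  proof -
    let ?u = "lattice_delta s :: real ^ 'n \<Rightarrow> real"
    let ?L = "lattice_point \<epsilon> ` Z"
    define f where "f x = (\<Sum>y\<in>neighbours \<epsilon> x. \<bar>?u y - ?u x\<bar>\<^sup>2)" for x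
    have cardL: "real (card ?L) \<le> real (card Z)" by (simp add: card_image_le fin)
    have f0: "f 0 \<le> real (card Z) * s\<^sup>2"
    proof -
      have sub: "neighbours \<epsilon> 0 \<subseteq> ?L"
        unfolding Z_def neighbours_def using l1_norm_eq_mesh_imp_unit_offset[OF \<epsilon>] by auto
      have "f 0 \<le> (\<Sum>y\<in>neighbours \<epsilon> (0 :: real ^ 'n). s\<^sup>2)"
        unfolding f_def by (rule sum_mono) (auto simp: lattice_delta_def)
      also have "\<dots> = real (card (neighbours \<epsilon> (0 :: real ^ 'n))) * s\<^sup>2" by simp
      also have "real (card (neighbours \<epsilon> (0 :: real ^ 'n))) \<le> real (card ?L)"
        using sub fin by (intro of_nat_mono card_mono) auto
      finally show ?thesis using cardL by (meson mult_right_mono order_trans zero_le_power2)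
    qed
    have fx: "f x \<le> s\<^sup>2" if "x \<noteq> 0" for x
    \<comment> \<open>In the infinite case the sum is 0 by convention.\<close>
    proof (cases "finite (neighbours \<epsilon> x)")
      case True
      have "f x = (\<Sum>y\<in>neighbours \<epsilon> x. if y = 0 then s\<^sup>2 else 0)"
        unfolding f_def using that by (intro sum.cong) (auto simp: lattice_delta_def)
      then show ?thesis using True by simp
    qed (simp add: f_def)
    have f_le: "f x \<le> real (card Z) * s\<^sup>2" for x
      using f0 fx[of x] mult_right_mono[OF Z1, of "s\<^sup>2"] by (cases "x = 0") auto
    have f_zero: "f x = 0" if "x \<in> lattice \<epsilon> - ?L" for x
    proof -
      have "0 \<notin> neighbours \<epsilon> x"
        using l1_norm_eq_mesh_imp_unit_offset[OF \<epsilon>, of x] that by (auto simp: neighbours_def Z_def)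
      moreover have "lattice_point \<epsilon> (0 :: int ^ 'n) = 0"
        by (simp add: lattice_point_def vec_eq_iff)
      then have "x \<noteq> 0" using that \<open>0 \<in> Z\<close> by (metis DiffD2 imageI)
      ultimately show ?thesis
        unfolding f_def by (intro sum.neutral) (auto simp: lattice_delta_def)
    qed
    have "infsum f (lattice \<epsilon>) = infsum f ?L"
      by (rule infsum_cong_neutral) (use f_zero in \<open>auto simp: lattice_def\<close>)
    also have "\<dots> = sum f ?L" using fin by simp
    also have "\<dots> \<le> real (card ?L) * (real (card Z) * s\<^sup>2)"
      using sum_bounded_above[of ?L f "real (card Z) * s\<^sup>2"] f_le by simp
    also have "\<dots> \<le> real (card Z) * (real (card Z) * s\<^sup>2)"
      by (intro mult_right_mono cardL) auto
    finally have "infsum f (lattice \<epsilon>) \<le> real (card Z) * (real (card Z) * s\<^sup>2)" .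
    then have "1 / (2 * \<epsilon>) * infsum f (lattice \<epsilon>) \<le> 1 / (2 * \<epsilon>) * (real (card Z) * (real (card Z) * s\<^sup>2))"
      using \<epsilon> by (intro mult_left_mono) auto
    then show ?thesis
      unfolding grad_norm_sq_def f_def[abs_def] by (simp add: power2_eq_square)
  qed
  then show ?thesis
    using Z1 by (intro that[of "(real (card Z))\<^sup>2 / 2"]) auto
qed

lemma energy_lattice_delta_le:
  fixes \<epsilon> p m K :: real
  assumes "m \<ge> 0" "p > 0" and K: "grad_norm_sq \<epsilon> (lattice_delta (sqrt m) :: real ^ 'n::finite \<Rightarrow> real) \<le> K * (sqrt m)\<^sup>2 / \<epsilon>"
  shows "lattice_energy_level TYPE('n) \<epsilon> p m \<le> ereal (K * m / (2 * \<epsilon>) - \<epsilon> / p * m powr (p / 2))"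
proof -
  let ?u = "lattice_delta (sqrt m) :: real ^ 'n \<Rightarrow> real"
  have "lattice_energy_level TYPE('n) \<epsilon> p m \<le> ereal (lattice_energy \<epsilon> p ?u)"
    unfolding lattice_energy_level_def by (rule INF_lower) (rule lattice_delta_in_mass[OF assms(1)])
  also have "lattice_energy \<epsilon> p ?u = 1 / 2 * grad_norm_sq \<epsilon> ?u - \<epsilon> / p * m powr (p / 2)"
    using assms(1,2) unfolding lattice_energy_def
    by (simp add: lq_norm_powr infsum_lattice_delta powr_half_sqrt[symmetric] powr_powr)
  also have "ereal \<dots> \<le> ereal (K * m / (2 * \<epsilon>) - \<epsilon> / p * m powr (p / 2))"
    using K assms(1) by simp
  finally show ?thesis .
qed

section \<open>Concentration and the lower bound for the interpolation\<close>

lemma infsum_abs_powr_le: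
  fixes u :: "real ^ 'n::finite \<Rightarrow> real"
  assumes p: "p > 2" and a: "a \<ge> 0" "\<And>x. x \<in> lattice \<epsilon> \<Longrightarrow> \<bar>u x\<bar> \<le> a"
    and u: "(\<lambda>x. \<bar>u x\<bar> powr 2) summable_on lattice \<epsilon>"
  shows "(\<Sum>\<^sub>\<infinity>x\<in>lattice \<epsilon>. \<bar>u x\<bar> powr p) \<le> a powr (p - 2) * (\<Sum>\<^sub>\<infinity>x\<in>lattice \<epsilon>. \<bar>u x\<bar> powr 2)"
proof (cases "(\<lambda>x. \<bar>u x\<bar> powr p) summable_on lattice \<epsilon>")
  case True
  have "\<bar>u x\<bar> powr p \<le> a powr (p - 2) * \<bar>u x\<bar> powr 2" if "x \<in> lattice \<epsilon>" for x
  proof -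
    have "\<bar>u x\<bar> powr p = \<bar>u x\<bar> powr (p - 2) * \<bar>u x\<bar> powr 2"
      using powr_add[of "\<bar>u x\<bar>" "p - 2" 2] by (simp only: diff_add_cancel)
    also have "\<dots> \<le> a powr (p - 2) * \<bar>u x\<bar> powr 2"
      using p a(2)[OF that] by (intro mult_right_mono powr_mono2) auto
    finally show ?thesis .
  qed
  then have "(\<Sum>\<^sub>\<infinity>x\<in>lattice \<epsilon>. \<bar>u x\<bar> powr p) \<le> (\<Sum>\<^sub>\<infinity>x\<in>lattice \<epsilon>. a powr (p - 2) * \<bar>u x\<bar> powr 2)"
    by (intro infsum_mono True summable_on_cmult_right u)
  then show ?thesis by (simp add: infsum_cmult_right')
next
  \<comment> \<open>The left-hand side is then 0 by convention, while the right-hand side is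
    nonnegative.\<close>
  case False
  then show ?thesis
    using infsum_abs_powr_nonneg[of u 2 \<epsilon>] by (simp add: infsum_not_exists)
qed

lemma summable_on_lattice_iff:
  fixes u :: "real ^ 'n::finite \<Rightarrow> real"
  assumes "\<epsilon> > 0"
  shows "(\<lambda>x. \<bar>u x\<bar> powr 2) summable_on lattice \<epsilon> \<longleftrightarrow> (\<lambda>k. (u (lattice_point \<epsilon> k))\<^sup>2) summable_on UNIV"
proof -
  have "inj (lattice_point \<epsilon> :: int ^ 'n \<Rightarrow> _)"
    using assms by (auto simp: inj_on_def lattice_point_def vec_eq_iff)
  from summable_on_reindex[OF this, of "\<lambda>x. \<bar>u x\<bar> powr 2"] show ?thesis
    by (simp add: lattice_def comp_def)
qed

text \<open>One partial derivative already suffices, so an arbitrary coordinate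
  \<open>undefined\<close> is tested. Existence of a weak derivative is what lets the choice in
  \<open>weak_partial\<close> be one; the factor 1/2 on a is the loss on the quarter cell.\<close>

lemma H1_norm_extension_op_ge:
  fixes u :: "real ^ 'n::finite \<Rightarrow> real"
  assumes \<epsilon>: "0 < \<epsilon>" "\<epsilon> \<le> 1" and u: "(\<lambda>x. \<bar>u x\<bar> powr 2) summable_on lattice \<epsilon>"
    and pos: "positive_on_lattice \<epsilon> u" and x: "x \<in> lattice \<epsilon>" and a: "0 \<le> a" "a \<le> u x"
  shows "sqrt ((exp (- 8) / 4) ^ CARD('n) * (a / 2) * sqrt (\<epsilon> ^ (CARD('n) - 1)) - 2) \<le>
    H1_norm (extension_op \<epsilon> u)"
proof -
  have u': "(\<lambda>k. (u (lattice_point \<epsilon> k))\<^sup>2) summable_on UNIV"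
    using u summable_on_lattice_iff[OF \<epsilon>(1)] by blast
  note bdd = summable_imp_lattice_bounded[OF u']
  let ?w = "kuhn \<epsilon> u" and ?i = "undefined :: 'n"
  have pos': "u (lattice_point \<epsilon> k) \<ge> 0" for k
    using pos by (auto simp: positive_on_lattice_def lattice_def intro: less_imp_le)
  obtain k where k: "x = lattice_point \<epsilon> k" using x by (auto simp: lattice_def)
  have g: "is_weak_partial ?i ?w (weak_partial ?i ?w)"
    unfolding weak_partial_def by (rule someI_ex[OF exists_weak_partial_kuhn[OF \<epsilon>(1) u']])
  have "(exp (- 8) / 4) ^ CARD('n) * (a / 2) * sqrt (\<epsilon> ^ (CARD('n) - 1)) \<le>
    (\<integral>x. (?w x)\<^sup>2 \<partial>lborel) + (\<integral>x. (weak_partial ?i ?w x)\<^sup>2 \<partial>lborel) + 2"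
  proof (rule weak_partial_lower_bound[OF square_integrable_kuhn[OF \<epsilon>(1) u'] _ g \<epsilon>, of "a / 2" "lattice_point \<epsilon> k"])
    show "0 \<le> ?w x" for x by (rule kuhn_ge_on_quarter_cell(1)[OF \<epsilon>(1) bdd pos'])
    show "0 \<le> a / 2" using a by simp
    show "a / 2 \<le> ?w x" if "x \<in> quarter_cell \<epsilon> (lattice_point \<epsilon> k)" for x
      using kuhn_ge_on_quarter_cell(2)[OF \<epsilon>(1) bdd pos' that] a(2) k by simp
  qed
  moreover have "(\<integral>x. (weak_partial ?i ?w x)\<^sup>2 \<partial>lborel) \<le> (\<Sum>i\<in>UNIV. \<integral>x. (weak_partial i ?w x)\<^sup>2 \<partial>lborel)"
    by (rule member_le_sum) auto
  ultimately show ?thesis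
    unfolding H1_norm_def extension_op_eq_kuhn[OF \<epsilon>(1) bdd] by (intro real_sqrt_le_mono) linarith
qed

text \<open>The powers of \<epsilon> add up to (d - 1) - d - 1 = -2 for the kinetic part and to (d -
  1) + 1 - d p / 2 = - d (p - 2) / 2 for the potential part.\<close>

lemma scaled_energy_bound_eq:
  fixes \<epsilon> \<mu> p K :: real
  assumes "\<epsilon> > 0" "\<mu> > 0" "d \<ge> 1"
  shows "\<epsilon> ^ (d - 1) * (K * (\<mu> / \<epsilon> ^ d) / (2 * \<epsilon>) - \<epsilon> / p * (\<mu> / \<epsilon> ^ d) powr (p / 2)) =
    K * \<mu> / 2 * \<epsilon> powr (- 2) - \<mu> powr (p / 2) / p * \<epsilon> powr (- (real d * (p - 2) / 2))"
proof -
  define X where "X = \<epsilon> ^ (d - 1)"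
  have X: "X > 0" using assms by (simp add: X_def)
  have Xd: "\<epsilon> ^ d = X * \<epsilon>"
    using power_minus_mult[of d \<epsilon>] assms(3) by (simp add: X_def)
  have Xd': "X * \<epsilon> = \<epsilon> powr real d"
    using assms(1) by (simp add: Xd[symmetric] powr_realpow)
  have "\<epsilon> powr (- 2) = 1 / (\<epsilon> * \<epsilon>)"
    using assms(1) by (simp add: powr_minus power2_eq_square divide_inverse)
  then have 1: "X * (K * (\<mu> / (X * \<epsilon>)) / (2 * \<epsilon>)) = K * \<mu> / 2 * \<epsilon> powr (- 2)"
    using X by simp
  have "(\<mu> / (X * \<epsilon>)) powr (p / 2) = \<mu> powr (p / 2) * \<epsilon> powr (- (real d * (p / 2)))"
    unfolding Xd' powr_minus_divide using assms by (simp add: powr_divide powr_powr)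
  then have "X * (\<epsilon> / p * (\<mu> / (X * \<epsilon>)) powr (p / 2)) =
      \<mu> powr (p / 2) / p * ((X * \<epsilon>) * \<epsilon> powr (- (real d * (p / 2))))"
    by simp
  also have "(X * \<epsilon>) * \<epsilon> powr (- (real d * (p / 2))) = \<epsilon> powr (real d + - (real d * (p / 2)))"
    unfolding Xd' powr_add ..
  also have "real d + - (real d * (p / 2)) = - (real d * (p - 2) / 2)"
    by (simp add: field_simps)
  finally have 2: "X * (\<epsilon> / p * (\<mu> / (X * \<epsilon>)) powr (p / 2)) =
      \<mu> powr (p / 2) / p * \<epsilon> powr (- (real d * (p - 2) / 2))" .
  show ?thesis
    unfolding X_def[symmetric] Xd right_diff_distrib 1 2 ..
qed

text \<open>The kinetic bound in \<open>energy\<close> is, by \<open>small\<close>, at most half of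
  the potential part, so the sum of |u|^p is at least m^(p/2) / 2. If u stayed below the stated
  height, interpolation between sup and l2 would give at most m^(p/2) / 4.\<close>

lemma concentration_point:
  fixes u :: "real ^ 'n::finite \<Rightarrow> real"
  assumes \<epsilon>: "\<epsilon> > 0" and p: "p > 2" and m: "m > 0" "(\<Sum>\<^sub>\<infinity>x\<in>lattice \<epsilon>. \<bar>u x\<bar> powr 2) = m"
    and pos: "positive_on_lattice \<epsilon> u"
    and energy: "lattice_energy \<epsilon> p u \<le> K * m / (2 * \<epsilon>) - \<epsilon> / p * m powr (p / 2)"
    and small: "2 * K * m / (2 * \<epsilon>) \<le> \<epsilon> / p * m powr (p / 2)"
  shows "\<exists>x \<in> lattice \<epsilon>. sqrt ((1 / 4) powr (2 / (p - 2)) * m) \<le> u x"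
proof (rule ccontr)
  \<comment> \<open>Chosen so that a^(p-2) * m = m^(p/2) / 4.\<close>
  define a where "a = sqrt ((1 / 4) powr (2 / (p - 2)) * m)"
  assume "\<not> (\<exists>x \<in> lattice \<epsilon>. sqrt ((1 / 4) powr (2 / (p - 2)) * m) \<le> u x)"
  then have ua: "\<bar>u x\<bar> \<le> a" if "x \<in> lattice \<epsilon>" for x
    using that pos by (auto simp: a_def positive_on_lattice_def not_le abs_of_pos less_imp_le)
  let ?S = "\<Sum>\<^sub>\<infinity>x\<in>lattice \<epsilon>. \<bar>u x\<bar> powr p"
  have a: "a \<ge> 0" using m by (simp add: a_def)
  \<comment> \<open>A family that is not summable would have the sum 0, contradicting m > 0.\<close>
  have summable: "(\<lambda>x. \<bar>u x\<bar> powr 2) summable_on lattice \<epsilon>"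
    using m infsum_not_exists by force
  have "?S \<le> a powr (p - 2) * m"
    using infsum_abs_powr_le[OF p a ua summable] m by simp
  also have "a powr (p - 2) = ((1 / 4) powr (2 / (p - 2)) * m) powr ((p - 2) / 2)"
    using m by (simp add: a_def powr_half_sqrt[symmetric] powr_powr)
  also have "\<dots> = 1 / 4 * m powr (p / 2 - 1)"
    using p m by (simp add: powr_mult powr_powr diff_divide_distrib)
  also have "1 / 4 * m powr (p / 2 - 1) * m = 1 / 4 * m powr (p / 2)"
    using m powr_add[of m "p / 2 - 1" 1] by simp
  finally have S: "?S \<le> 1 / 4 * m powr (p / 2)" .
  have "lattice_energy \<epsilon> p u = 1 / 2 * grad_norm_sq \<epsilon> u - \<epsilon> / p * ?S"
    using p by (simp add: lattice_energy_def lq_norm_powr)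
  then have "\<epsilon> / p * ?S \<ge> \<epsilon> / p * m powr (p / 2) - K * m / (2 * \<epsilon>)"
    using energy grad_norm_sq_nonneg[OF \<epsilon>, of u] by linarith
  moreover have "2 * (K * m / (2 * \<epsilon>)) \<le> \<epsilon> / p * m powr (p / 2)"
    using small by simp
  moreover have "\<epsilon> / p * ?S \<le> \<epsilon> / p * (1 / 4 * m powr (p / 2))"
    using \<epsilon> p by (intro mult_left_mono S) auto
  moreover have "\<epsilon> / p * m powr (p / 2) > 0"
    using \<epsilon> p m by simp
  ultimately show False by argo
qed

section \<open>Divergence of the energy level and of the interpolated ground states\<close>

theorem theorem1p4:
  fixes p \<mu> :: real
  assumes "CARD('n::finite) \<ge> 2"
    and "p > 2 + 4 / real CARD('n)"
    and "\<mu> > 0"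
  shows "((\<lambda>\<epsilon>::real. ereal (\<epsilon> ^ (CARD('n) - 1)) *
            lattice_energy_level TYPE('n) \<epsilon> p (\<mu> / \<epsilon> ^ CARD('n))) \<longlongrightarrow> -\<infinity>) (at_right 0) \<and>
         (\<forall>u :: real \<Rightarrow> real ^ 'n \<Rightarrow> real.
            (\<forall>\<^sub>F \<epsilon> in at_right 0. ground_state \<epsilon> p (\<mu> / \<epsilon> ^ CARD('n)) (u \<epsilon>) \<and>
                                 positive_on_lattice \<epsilon> (u \<epsilon>)) \<longrightarrow>
            filterlim (\<lambda>\<epsilon>. H1_norm (extension_op \<epsilon> (u \<epsilon>))) at_top (at_right 0))"
proof -
  let ?d = "CARD('n)"
  let ?m = "\<lambda>\<epsilon>. \<mu> / \<epsilon> ^ ?d"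
  have d: "1 \<le> ?d" using assms(1) by simp
  have p: "p > 2"
    using assms(1,2) by (smt (verit) divide_nonneg_nonneg of_nat_0_le_iff)
  have "p - 2 > 4 / real ?d" using assms(2) by simp
  then have r: "real ?d * (p - 2) / 2 > 2"
    using assms(1) by (simp add: field_simps)
  obtain K where K: "K > 0"
    "\<And>\<epsilon> s. \<epsilon> > 0 \<Longrightarrow> grad_norm_sq \<epsilon> (lattice_delta s :: real ^ 'n \<Rightarrow> real) \<le> K * s\<^sup>2 / \<epsilon>"
    using grad_norm_sq_lattice_delta_le by blast
  let ?R = "\<lambda>K \<epsilon>. K * ?m \<epsilon> / (2 * \<epsilon>) - \<epsilon> / p * ?m \<epsilon> powr (p / 2)"
  have level: "lattice_energy_level TYPE('n) \<epsilon> p (?m \<epsilon>) \<le> ereal (?R K \<epsilon>)" if "\<epsilon> > 0" for \<epsilon>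
    using that assms(3) p by (intro energy_lattice_delta_le K(2)) auto
  have pos: "\<forall>\<^sub>F \<epsilon> in at_right 0. (0 :: real) < \<epsilon>"
    by (rule eventually_at_right_less)
  \<comment> \<open>Stated for every positive constant: K gives the divergence of the level, and 2 K
    gives the domination of the kinetic part by the potential part required in
    \<open>concentration_point\<close>.\<close>
  have R_lim: "filterlim (\<lambda>\<epsilon>. \<epsilon> ^ (?d - 1) * ?R K' \<epsilon>) at_bot (at_right 0)" if "K' > 0" for K'
  proof -
    have lim: "filterlim (\<lambda>\<epsilon>. A * \<epsilon> powr (- 2) - b * \<epsilon> powr (- s)) at_bot (at_right (0 :: real))"
      if "A > 0" "b > 0" "s > 2" for A b s :: real
      using that by real_asymp
    have "filterlim (\<lambda>\<epsilon>. K' * \<mu> / 2 * \<epsilon> powr (- 2) - \<mu> powr (p / 2) / p * \<epsilon> powr (- (real ?d * (p - 2) / 2)))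
        at_bot (at_right 0)"
      using that r p assms(3) by (intro lim) auto
    moreover have "\<forall>\<^sub>F \<epsilon> in at_right 0. \<epsilon> ^ (?d - 1) * ?R K' \<epsilon> =
        K' * \<mu> / 2 * \<epsilon> powr (- 2) - \<mu> powr (p / 2) / p * \<epsilon> powr (- (real ?d * (p - 2) / 2))"
      using pos by eventually_elim (rule scaled_energy_bound_eq[OF _ assms(3) d])
    ultimately show ?thesis
      using filterlim_cong by fastforce
  qed
  have "((\<lambda>\<epsilon>::real. ereal (\<epsilon> ^ (?d - 1)) * lattice_energy_level TYPE('n) \<epsilon> p (?m \<epsilon>)) \<longlongrightarrow> -\<infinity>) (at_right 0)"
  \<comment> \<open>Only the upper bound has content; the constant lower bound also covers a level
    equal to minus infinity.\<close>
  proof (rule tendsto_sandwich[where f = "\<lambda>_. -\<infinity>"])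
    show "((\<lambda>\<epsilon>. ereal (\<epsilon> ^ (?d - 1) * ?R K \<epsilon>)) \<longlongrightarrow> -\<infinity>) (at_right 0)"
      using R_lim[OF K(1)] unfolding tendsto_MInfty filterlim_at_bot_dense ereal_less_eq less_ereal.simps .
    show "\<forall>\<^sub>F \<epsilon> in at_right 0. ereal (\<epsilon> ^ (?d - 1)) * lattice_energy_level TYPE('n) \<epsilon> p (?m \<epsilon>)
        \<le> ereal (\<epsilon> ^ (?d - 1) * ?R K \<epsilon>)"
      using pos
    proof eventually_elim
      case (elim \<epsilon>)
      have "ereal (\<epsilon> ^ (?d - 1)) * lattice_energy_level TYPE('n) \<epsilon> p (?m \<epsilon>) \<le>
          ereal (\<epsilon> ^ (?d - 1)) * ereal (?R K \<epsilon>)"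
        using elim by (intro ereal_mult_left_mono level) auto
      then show ?case by (simp only: times_ereal.simps)
    qed
  qed auto
  moreover have "filterlim (\<lambda>\<epsilon>. H1_norm (extension_op \<epsilon> (u \<epsilon>))) at_top (at_right 0)"
    if gs: "\<forall>\<^sub>F \<epsilon> in at_right 0. ground_state \<epsilon> p (?m \<epsilon>) (u \<epsilon>) \<and> positive_on_lattice \<epsilon> (u \<epsilon>)"
    for u :: "real \<Rightarrow> real ^ 'n \<Rightarrow> real"
  proof -
    \<comment> \<open>The squared height of the concentration point is \<theta> / \<epsilon>^d, so
      its product with the tube volume \<epsilon>^(d-1) is \<theta> / \<epsilon>. This produces the
      rate C * sqrt (\<theta> / \<epsilon>).\<close>
    define \<theta> where "\<theta> = (1 / 4 :: real) powr (2 / (p - 2)) * \<mu>"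
    define C where "C = (exp (- 8) / 4 :: real) ^ ?d / 2"
    have \<theta>: "\<theta> > 0" using assms(3) by (simp add: \<theta>_def)
    have C: "C > 0" by (simp add: C_def)
    have small: "\<forall>\<^sub>F \<epsilon> in at_right 0. \<epsilon> ^ (?d - 1) * ?R (2 * K) \<epsilon> \<le> 0"
      using R_lim[of "2 * K"] K(1) unfolding filterlim_at_bot by simp
    have le1: "\<forall>\<^sub>F \<epsilon> in at_right 0. \<epsilon> \<le> (1 :: real)"
      using eventually_at_right_real[of 0 "1 :: real"] by (auto elim: eventually_mono)
    show ?thesis
    proof (rule filterlim_at_top_mono)
      show "filterlim (\<lambda>\<epsilon>. sqrt (C * sqrt (\<theta> / \<epsilon>) - 2)) at_top (at_right 0)"
        using \<theta> C by real_asymp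
      show "\<forall>\<^sub>F \<epsilon> in at_right 0. sqrt (C * sqrt (\<theta> / \<epsilon>) - 2) \<le> H1_norm (extension_op \<epsilon> (u \<epsilon>))"
        using gs small le1 pos
      proof eventually_elim
        fix \<epsilon> :: real
        assume g: "ground_state \<epsilon> p (?m \<epsilon>) (u \<epsilon>) \<and> positive_on_lattice \<epsilon> (u \<epsilon>)"
          and s: "\<epsilon> ^ (?d - 1) * ?R (2 * K) \<epsilon> \<le> 0" and \<epsilon>1: "\<epsilon> \<le> 1" and \<epsilon>: "0 < \<epsilon>"
        have m: "?m \<epsilon> > 0" using assms(3) \<epsilon> by simp
        have mass: "(\<Sum>\<^sub>\<infinity>x\<in>lattice \<epsilon>. \<bar>u \<epsilon> x\<bar> powr 2) = ?m \<epsilon>"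
          using g by (simp only: ground_state_def lattice_H1_mass_def lq_norm_2_power2 mem_Collect_eq)
        have summable: "(\<lambda>x. \<bar>u \<epsilon> x\<bar> powr 2) summable_on lattice \<epsilon>"
        proof (rule ccontr)
          assume "\<not> ?thesis"
          from infsum_not_exists[OF this] m show False unfolding mass by (simp only: less_irrefl)
        qed
        have "ereal (lattice_energy \<epsilon> p (u \<epsilon>)) \<le> ereal (?R K \<epsilon>)"
          using g level[OF \<epsilon>] by (simp only: ground_state_def)
        then have energy: "lattice_energy \<epsilon> p (u \<epsilon>) \<le> ?R K \<epsilon>" by simp
        have "\<epsilon> ^ (?d - 1) * ?R (2 * K) \<epsilon> \<le> \<epsilon> ^ (?d - 1) * 0"
          using s by (simp only: mult_zero_right)
        then have "?R (2 * K) \<epsilon> \<le> 0"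
          unfolding mult_le_cancel_left_pos[OF zero_less_power[OF \<epsilon>]] .
        then have "2 * K * ?m \<epsilon> / (2 * \<epsilon>) \<le> \<epsilon> / p * ?m \<epsilon> powr (p / 2)"
          by linarith
        from concentration_point[OF \<epsilon> p m mass conjunct2[OF g] energy this]
        obtain x where x: "x \<in> lattice \<epsilon>" "sqrt ((1 / 4) powr (2 / (p - 2)) * ?m \<epsilon>) \<le> u \<epsilon> x"
          by blast
        let ?a = "sqrt ((1 / 4) powr (2 / (p - 2)) * ?m \<epsilon>)"
        have "\<epsilon> ^ ?d = \<epsilon> ^ (?d - 1) * \<epsilon>" using power_minus_mult[of ?d \<epsilon>] d by simp
        then have "(1 / 4) powr (2 / (p - 2)) * ?m \<epsilon> * \<epsilon> ^ (?d - 1) = \<theta> / \<epsilon>"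
          using \<epsilon> by (simp add: \<theta>_def)
        then have "?a * sqrt (\<epsilon> ^ (?d - 1)) = sqrt (\<theta> / \<epsilon>)"
          by (simp only: real_sqrt_mult[symmetric])
        then have "(exp (- 8) / 4) ^ ?d * (?a / 2) * sqrt (\<epsilon> ^ (?d - 1)) = C * sqrt (\<theta> / \<epsilon>)"
          by (simp add: C_def)
        moreover have "?a \<ge> 0" using assms(3) \<epsilon> by simp
        ultimately show "sqrt (C * sqrt (\<theta> / \<epsilon>) - 2) \<le> H1_norm (extension_op \<epsilon> (u \<epsilon>))"
          using H1_norm_extension_op_ge[OF \<epsilon> \<epsilon>1 summable conjunct2[OF g] x(1) _ x(2)] by (simp only:)
      qed
    qed
  qed
  ultimately show ?thesis by blast
qed

end
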